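(* Let $\mathbb T$ be a CSC-theory. Then the syntactic quadruple $(S(\mathbb T),\mathcal T,\mathcal S,\iota)$ is a CSC-model, and the canonical interpretation of $\mathbb T$ in it (sending each type $A$ to $[A]$ and each term to its equivalence class) is sound and complete: $\vdash A=B:\mathtt{type}$ is derivable in $\mathbb T$ iff $[\![A]\!]=[\![B]\!]$, and $\Gamma\vdash M=N:A$ is derivable in $\mathbb T$ iff $[\![\Gamma\vdash M:A]\!]=[\![\Gamma\vdash N:A]\!]$.
   Context: CSC (Central Submonad Calculus): types $A,B::=G\mid 1\mid A\to B\mid A\times B\mid\mathcal SA\mid\mathcal TA$; terms $x\mid *\mid\lambda x^A.M\mid MN\mid\langle M,N\rangle\mid\pi_iM\mid\mathtt{ret}_{\mathcal X}M\mid\iota M\mid\mathtt{do}_{\mathcal X}x\leftarrow M;N$ ($\mathcal X\in\{\mathcal S,\mathcal T\}$), typed by the usual simply-typed rules plus $\mathtt{ret}_{\mathcal X}:A\Rightarrow\mathcal XA$, $\iota:\mathcal SA\Rightarrow\mathcal TA$, and $\Gamma\vdash M:\mathcal XA$, $\Gamma,x:A\vdash N:\mathcal XB$ give $\Gamma\vdash\mathtt{do}_{\mathcal X}x\leftarrow M;N:\mathcal XB$; judgements closed under weakening. Type equality is a congruent equivalence relation respected by typing. Term equality is a congruent equivalence relation closed under substitution and weakening containing the $\beta\eta$ laws for $1,\times,\to$; for each $\mathcal X$ the monad laws ($\mathtt{do}_{\mathcal X}x\leftarrow\mathtt{ret}_{\mathcal X}M;N=N[M/x]$, $\mathtt{do}_{\mathcal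 X}x\leftarrow M;\mathtt{ret}_{\mathcal X}x=M$, associativity $\mathtt{do}_{\mathcal X}y\leftarrow(\mathtt{do}_{\mathcal X}x\leftarrow M;N);P=\mathtt{do}_{\mathcal X}x\leftarrow M;\mathtt{do}_{\mathcal X}y\leftarrow N;P$); centrality $\mathtt{do}_{\mathcal T}x\leftarrow\iota M;\mathtt{do}_{\mathcal T}y\leftarrow N;P=\mathtt{do}_{\mathcal T}y\leftarrow N;\mathtt{do}_{\mathcal T}x\leftarrow\iota M;P$ for $M:\mathcal SA$, $N:\mathcal TB$; $\iota M=\iota N$ iff $M=N$; $\mathtt{do}_{\mathcal T}x\leftarrow\iota M;\iota N=\iota(\mathtt{do}_{\mathcal S}x\leftarrow M;N)$; $\iota(\mathtt{ret}_{\mathcal S}M)=\mathtt{ret}_{\mathcal T}M$. A CSC-theory extends CSC by new ground types, term constants (well-formed in every context) and type/term equality axioms. $S(\mathbb T)$ is the category of types modulo type equality and judgements $x:A\vdash f:B$ modulo provable equality, with composition by substitution; on it $\mathcal X[A]=[\mathcal XA]$, $\eta^{\mathcal X}=[x\vdash\mathtt{ret}_{\mathcal X}x]$, $\mu^{\mathcal X}=[x\vdash\mathtt{do}_{\mathcal X}y\leftarrow x;y]$, $\tau^{\mathcal X}=[x\vdash\mathtt{do}_{\mathcal X}y\leftarrow\pi_2x;\mathtt{ret}_{\mathcal X}\langle\pi_1x,y\rangle]$, $\iota_{[A]}=[x:\mathcal SA\vdash\iota x:\mathcal TA]$. A CSC-model is a cartesian closed category with a strong monad $\mathcal T$ and a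 central submonad $\mathcal S$ (strong submonad $\iota:\mathcal S\Rightarrow\mathcal T$, monic morphism of strong monads, such that every $(\mathcal SX,\iota_X)$ is a central cone: $\mu\circ\mathcal T\tau'\circ\tau\circ(\iota_X\times\mathrm{id})=\mu\circ\mathcal T\tau\circ\tau'\circ(\iota_X\times\mathrm{id}):\mathcal SX\times\mathcal TY\to\mathcal T(X\times Y)$ for all $Y$, $\tau'$ the right strength). An interpretation maps ground types to objects, $1,\to,\times,\mathcal S,\mathcal T$ to terminal object, exponential, product, $\mathcal S,\mathcal T$, contexts to products, and terms $\Gamma\vdash M:A$ to morphisms $[\![\Gamma]\!]\to[\![A]\!]$ in the standard way for the $\lambda$-calculus, with $[\![\mathtt{ret}_{\mathcal X}M]\!]=\eta^{\mathcal X}\circ[\![M]\!]$, $[\![\iota M]\!]=\iota\circ[\![M]\!]$, $[\![\mathtt{do}_{\mathcal X}x\leftarrow M;N]\!]=\mu^{\mathcal X}\circ\mathcal X[\![N]\!]\circ\tau^{\mathcal X}\circ\langle\mathrm{id},[\![M]\!]\rangle$. *)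

theory Defs
  imports Main
begin

section \<open>Syntax of the Central Submonad Calculus\<close>

datatype monad_sym = MS | MT

datatype 'g ty =
    Ground 'g
  | Unit
  | Fun "'g ty" "'g ty"
  | Prod "'g ty" "'g ty"
  | Mon monad_sym "'g ty"

text \<open>
  Terms up to alpha-equivalence, with de Bruijn indices. \<open>Lam A M\<close> and the second argument of
  \<open>Do X M N\<close> bind index 0. A context lists the most recently bound variable first, so that
  \<open>\<Gamma>, x : A\<close> is \<open>A # \<Gamma>\<close>.
\<close>

datatype ('g, 'c) tm =
    Var nat
  | Const 'c
  | Star
  | Lam "'g ty" "('g, 'c) tm"
  | App "('g, 'c) tm" "('g, 'c) tm"
  | Pair "('g, 'c) tm" "('g, 'c) tm"
  | Pr1 "('g, 'c) tm"
  | Pr2 "('g, 'c) tm"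
  | Ret monad_sym "('g, 'c) tm"
  | Iota "('g, 'c) tm"
  | Do monad_sym "('g, 'c) tm" "('g, 'c) tm"

type_synonym 'g ctx = "'g ty list"

definition up_ren :: "(nat \<Rightarrow> nat) \<Rightarrow> nat \<Rightarrow> nat" where
  "up_ren r = case_nat 0 (\<lambda>n. Suc (r n))"

primrec ren :: "('g, 'c) tm \<Rightarrow> (nat \<Rightarrow> nat) \<Rightarrow> ('g, 'c) tm" where
  "ren (Var n) r = Var (r n)"
| "ren (Const c) r = Const c"
| "ren Star r = Star"
| "ren (Lam A M) r = Lam A (ren M (up_ren r))"
| "ren (App M N) r = App (ren M r) (ren N r)"
| "ren (Pair M N) r = Pair (ren M r) (ren N r)"
| "ren (Pr1 M) r = Pr1 (ren M r)"
| "ren (Pr2 M) r = Pr2 (ren M r)"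
| "ren (Ret X M) r = Ret X (ren M r)"
| "ren (Iota M) r = Iota (ren M r)"
| "ren (Do X M N) r = Do X (ren M r) (ren N (up_ren r))"

abbreviation lift :: "('g, 'c) tm \<Rightarrow> ('g, 'c) tm" where
  "lift M \<equiv> ren M Suc"

definition up_sub :: "(nat \<Rightarrow> ('g, 'c) tm) \<Rightarrow> nat \<Rightarrow> ('g, 'c) tm" where
  "up_sub s = case_nat (Var 0) (\<lambda>n. lift (s n))"

primrec sub :: "('g, 'c) tm \<Rightarrow> (nat \<Rightarrow> ('g, 'c) tm) \<Rightarrow> ('g, 'c) tm" where
  "sub (Var n) s = s n"
| "sub (Const c) s = Const c"
| "sub Star s = Star"
| "sub (Lam A M) s = Lam A (sub M (up_sub s))"
| "sub (App M N) s = App (sub M s) (sub N s)"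
| "sub (Pair M N) s = Pair (sub M s) (sub N s)"
| "sub (Pr1 M) s = Pr1 (sub M s)"
| "sub (Pr2 M) s = Pr2 (sub M s)"
| "sub (Ret X M) s = Ret X (sub M s)"
| "sub (Iota M) s = Iota (sub M s)"
| "sub (Do X M N) s = Do X (sub M s) (sub N (up_sub s))"

text \<open>\<open>inst M N\<close> is \<open>M[N/x]\<close>, where \<open>x\<close> is index 0 of \<open>M\<close>.\<close>

definition inst :: "('g, 'c) tm \<Rightarrow> ('g, 'c) tm \<Rightarrow> ('g, 'c) tm" where
  "inst M N = sub M (case_nat N Var)"

text \<open>Exchange of the two most recently bound variables.\<close>

definition swap_vars :: "('g, 'c) tm \<Rightarrow> ('g, 'c) tm" where
  "swap_vars M = ren M (\<lambda>n. if n = 0 then 1 else if n = 1 then 0 else n)"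


section \<open>Judgements of a CSC-theory\<close>

text \<open>
  The ground types are a set and the constants a partial map, so that a theory may have none.
  A term axiom \<open>(\<Gamma>, M, N, A)\<close> stands for \<open>\<Gamma> \<turnstile> M = N : A\<close>.
\<close>

record ('g, 'c) csc_presentation =
  ground :: "'g set"
  const_ty :: "'c \<Rightarrow> 'g ty option"
  ty_ax :: "('g ty \<times> 'g ty) set"
  tm_ax :: "('g ctx \<times> ('g, 'c) tm \<times> ('g, 'c) tm \<times> 'g ty) set"

definition wf_ty :: "('g, 'c) csc_presentation \<Rightarrow> 'g ty \<Rightarrow> bool" where
  "wf_ty \<Theta> A \<longleftrightarrow> set_ty A \<subseteq> ground \<Theta>"

definition wf_ctx :: "('g, 'c) csc_presentation \<Rightarrow> 'g ctx \<Rightarrow> bool" where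
  "wf_ctx \<Theta> \<Gamma> \<longleftrightarrow> (\<forall>A \<in> set \<Gamma>. wf_ty \<Theta> A)"

inductive ty_eq :: "('g, 'c) csc_presentation \<Rightarrow> 'g ty \<Rightarrow> 'g ty \<Rightarrow> bool"
    ("_ \<rhd>\<^sub>t _ \<approx> _" [51, 51, 51] 50)
  for \<Theta> :: "('g, 'c) csc_presentation" where
  ty_axiom: "(A, B) \<in> ty_ax \<Theta> \<Longrightarrow> \<Theta> \<rhd>\<^sub>t A \<approx> B"
| ty_refl: "wf_ty \<Theta> A \<Longrightarrow> \<Theta> \<rhd>\<^sub>t A \<approx> A"
| ty_sym: "\<Theta> \<rhd>\<^sub>t A \<approx> B \<Longrightarrow> \<Theta> \<rhd>\<^sub>t B \<approx> A"
| ty_trans: "\<Theta> \<rhd>\<^sub>t A \<approx> B \<Longrightarrow> \<Theta> \<rhd>\<^sub>t B \<approx> C \<Longrightarrow> \<Theta> \<rhd>\<^sub>t A \<approx> C"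
| ty_fun: "\<Theta> \<rhd>\<^sub>t A \<approx> A' \<Longrightarrow> \<Theta> \<rhd>\<^sub>t B \<approx> B' \<Longrightarrow> \<Theta> \<rhd>\<^sub>t Fun A B \<approx> Fun A' B'"
| ty_prod: "\<Theta> \<rhd>\<^sub>t A \<approx> A' \<Longrightarrow> \<Theta> \<rhd>\<^sub>t B \<approx> B' \<Longrightarrow> \<Theta> \<rhd>\<^sub>t Prod A B \<approx> Prod A' B'"
| ty_mon: "\<Theta> \<rhd>\<^sub>t A \<approx> A' \<Longrightarrow> \<Theta> \<rhd>\<^sub>t Mon X A \<approx> Mon X A'"

text \<open>
  Weakening and conversion of the context are admissible for typing, by the lookup rule for
  variables.
\<close>

inductive has_ty :: "('g, 'c) csc_presentation \<Rightarrow> 'g ctx \<Rightarrow> ('g, 'c) tm \<Rightarrow> 'g ty \<Rightarrow> bool"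
    ("_ \<rhd> _ \<turnstile> _ \<Colon> _" [51, 51, 51, 51] 50)
  for \<Theta> :: "('g, 'c) csc_presentation" where
  t_var: "wf_ctx \<Theta> \<Gamma> \<Longrightarrow> n < length \<Gamma> \<Longrightarrow> \<Theta> \<rhd> \<Gamma> \<turnstile> Var n \<Colon> \<Gamma> ! n"
| t_const: "wf_ctx \<Theta> \<Gamma> \<Longrightarrow> const_ty \<Theta> c = Some A \<Longrightarrow> \<Theta> \<rhd> \<Gamma> \<turnstile> Const c \<Colon> A"
| t_star: "wf_ctx \<Theta> \<Gamma> \<Longrightarrow> \<Theta> \<rhd> \<Gamma> \<turnstile> Star \<Colon> Unit"
| t_lam: "\<Theta> \<rhd> A # \<Gamma> \<turnstile> M \<Colon> B \<Longrightarrow> \<Theta> \<rhd> \<Gamma> \<turnstile> Lam A M \<Colon> Fun A B"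
| t_app: "\<Theta> \<rhd> \<Gamma> \<turnstile> M \<Colon> Fun A B \<Longrightarrow> \<Theta> \<rhd> \<Gamma> \<turnstile> N \<Colon> A \<Longrightarrow> \<Theta> \<rhd> \<Gamma> \<turnstile> App M N \<Colon> B"
| t_pair: "\<Theta> \<rhd> \<Gamma> \<turnstile> M \<Colon> A \<Longrightarrow> \<Theta> \<rhd> \<Gamma> \<turnstile> N \<Colon> B \<Longrightarrow> \<Theta> \<rhd> \<Gamma> \<turnstile> Pair M N \<Colon> Prod A B"
| t_pr1: "\<Theta> \<rhd> \<Gamma> \<turnstile> M \<Colon> Prod A B \<Longrightarrow> \<Theta> \<rhd> \<Gamma> \<turnstile> Pr1 M \<Colon> A"
| t_pr2: "\<Theta> \<rhd> \<Gamma> \<turnstile> M \<Colon> Prod A B \<Longrightarrow> \<Theta> \<rhd> \<Gamma> \<turnstile> Pr2 M \<Colon> B"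
| t_ret: "\<Theta> \<rhd> \<Gamma> \<turnstile> M \<Colon> A \<Longrightarrow> \<Theta> \<rhd> \<Gamma> \<turnstile> Ret X M \<Colon> Mon X A"
| t_iota: "\<Theta> \<rhd> \<Gamma> \<turnstile> M \<Colon> Mon MS A \<Longrightarrow> \<Theta> \<rhd> \<Gamma> \<turnstile> Iota M \<Colon> Mon MT A"
| t_do: "\<Theta> \<rhd> \<Gamma> \<turnstile> M \<Colon> Mon X A \<Longrightarrow> \<Theta> \<rhd> A # \<Gamma> \<turnstile> N \<Colon> Mon X B \<Longrightarrow> \<Theta> \<rhd> \<Gamma> \<turnstile> Do X M N \<Colon> Mon X B"
| t_conv: "\<Theta> \<rhd> \<Gamma> \<turnstile> M \<Colon> A \<Longrightarrow> \<Theta> \<rhd>\<^sub>t A \<approx> B \<Longrightarrow> \<Theta> \<rhd> \<Gamma> \<turnstile> M \<Colon> B"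

inductive tm_eq ::
    "('g, 'c) csc_presentation \<Rightarrow> 'g ctx \<Rightarrow> ('g, 'c) tm \<Rightarrow> ('g, 'c) tm \<Rightarrow> 'g ty \<Rightarrow> bool"
    ("_ \<rhd> _ \<turnstile> _ \<approx> _ \<Colon> _" [51, 51, 51, 51, 51] 50)
  for \<Theta> :: "('g, 'c) csc_presentation" where
  e_axiom: "(\<Gamma>, M, N, A) \<in> tm_ax \<Theta> \<Longrightarrow> \<Theta> \<rhd> \<Gamma> \<turnstile> M \<approx> N \<Colon> A"
| e_refl: "\<Theta> \<rhd> \<Gamma> \<turnstile> M \<Colon> A \<Longrightarrow> \<Theta> \<rhd> \<Gamma> \<turnstile> M \<approx> M \<Colon> A"
| e_sym: "\<Theta> \<rhd> \<Gamma> \<turnstile> M \<approx> N \<Colon> A \<Longrightarrow> \<Theta> \<rhd> \<Gamma> \<turnstile> N \<approx> M \<Colon> A"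
| e_trans: "\<Theta> \<rhd> \<Gamma> \<turnstile> M \<approx> N \<Colon> A \<Longrightarrow> \<Theta> \<rhd> \<Gamma> \<turnstile> N \<approx> P \<Colon> A \<Longrightarrow> \<Theta> \<rhd> \<Gamma> \<turnstile> M \<approx> P \<Colon> A"
| e_conv: "\<Theta> \<rhd> \<Gamma> \<turnstile> M \<approx> N \<Colon> A \<Longrightarrow> \<Theta> \<rhd>\<^sub>t A \<approx> B \<Longrightarrow> \<Theta> \<rhd> \<Gamma> \<turnstile> M \<approx> N \<Colon> B"
| e_weak: "\<Theta> \<rhd> \<Gamma> \<turnstile> M \<approx> N \<Colon> B \<Longrightarrow> wf_ty \<Theta> A \<Longrightarrow> \<Theta> \<rhd> A # \<Gamma> \<turnstile> lift M \<approx> lift N \<Colon> B"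
| e_subst: "\<Theta> \<rhd> A # \<Gamma> \<turnstile> M \<approx> N \<Colon> B \<Longrightarrow> \<Theta> \<rhd> \<Gamma> \<turnstile> P \<Colon> A \<Longrightarrow> \<Theta> \<rhd> \<Gamma> \<turnstile> inst M P \<approx> inst N P \<Colon> B"
| e_lam: "\<Theta> \<rhd>\<^sub>t A \<approx> A' \<Longrightarrow> \<Theta> \<rhd> A # \<Gamma> \<turnstile> M \<approx> M' \<Colon> B
    \<Longrightarrow> \<Theta> \<rhd> \<Gamma> \<turnstile> Lam A M \<approx> Lam A' M' \<Colon> Fun A B"
| e_app: "\<Theta> \<rhd> \<Gamma> \<turnstile> M \<approx> M' \<Colon> Fun A B \<Longrightarrow> \<Theta> \<rhd> \<Gamma> \<turnstile> N \<approx> N' \<Colon> A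
    \<Longrightarrow> \<Theta> \<rhd> \<Gamma> \<turnstile> App M N \<approx> App M' N' \<Colon> B"
| e_pair: "\<Theta> \<rhd> \<Gamma> \<turnstile> M \<approx> M' \<Colon> A \<Longrightarrow> \<Theta> \<rhd> \<Gamma> \<turnstile> N \<approx> N' \<Colon> B
    \<Longrightarrow> \<Theta> \<rhd> \<Gamma> \<turnstile> Pair M N \<approx> Pair M' N' \<Colon> Prod A B"
| e_pr1: "\<Theta> \<rhd> \<Gamma> \<turnstile> M \<approx> M' \<Colon> Prod A B \<Longrightarrow> \<Theta> \<rhd> \<Gamma> \<turnstile> Pr1 M \<approx> Pr1 M' \<Colon> A"
| e_pr2: "\<Theta> \<rhd> \<Gamma> \<turnstile> M \<approx> M' \<Colon> Prod A B \<Longrightarrow> \<Theta> \<rhd> \<Gamma> \<turnstile> Pr2 M \<approx> Pr2 M' \<Colon> B"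
| e_ret: "\<Theta> \<rhd> \<Gamma> \<turnstile> M \<approx> M' \<Colon> A \<Longrightarrow> \<Theta> \<rhd> \<Gamma> \<turnstile> Ret X M \<approx> Ret X M' \<Colon> Mon X A"
| e_iota: "\<Theta> \<rhd> \<Gamma> \<turnstile> M \<approx> M' \<Colon> Mon MS A \<Longrightarrow> \<Theta> \<rhd> \<Gamma> \<turnstile> Iota M \<approx> Iota M' \<Colon> Mon MT A"
| e_do: "\<Theta> \<rhd> \<Gamma> \<turnstile> M \<approx> M' \<Colon> Mon X A \<Longrightarrow> \<Theta> \<rhd> A # \<Gamma> \<turnstile> N \<approx> N' \<Colon> Mon X B
    \<Longrightarrow> \<Theta> \<rhd> \<Gamma> \<turnstile> Do X M N \<approx> Do X M' N' \<Colon> Mon X B"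
| e_unit_eta: "\<Theta> \<rhd> \<Gamma> \<turnstile> M \<Colon> Unit \<Longrightarrow> \<Theta> \<rhd> \<Gamma> \<turnstile> M \<approx> Star \<Colon> Unit"
| e_fun_beta: "\<Theta> \<rhd> A # \<Gamma> \<turnstile> M \<Colon> B \<Longrightarrow> \<Theta> \<rhd> \<Gamma> \<turnstile> N \<Colon> A
    \<Longrightarrow> \<Theta> \<rhd> \<Gamma> \<turnstile> App (Lam A M) N \<approx> inst M N \<Colon> B"
| e_fun_eta: "\<Theta> \<rhd> \<Gamma> \<turnstile> M \<Colon> Fun A B
    \<Longrightarrow> \<Theta> \<rhd> \<Gamma> \<turnstile> Lam A (App (lift M) (Var 0)) \<approx> M \<Colon> Fun A B"
| e_pr1_beta: "\<Theta> \<rhd> \<Gamma> \<turnstile> M \<Colon> A \<Longrightarrow> \<Theta> \<rhd> \<Gamma> \<turnstile> N \<Colon> B \<Longrightarrow> \<Theta> \<rhd> \<Gamma> \<turnstile> Pr1 (Pair M N) \<approx> M \<Colon> A"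
| e_pr2_beta: "\<Theta> \<rhd> \<Gamma> \<turnstile> M \<Colon> A \<Longrightarrow> \<Theta> \<rhd> \<Gamma> \<turnstile> N \<Colon> B \<Longrightarrow> \<Theta> \<rhd> \<Gamma> \<turnstile> Pr2 (Pair M N) \<approx> N \<Colon> B"
| e_prod_eta: "\<Theta> \<rhd> \<Gamma> \<turnstile> M \<Colon> Prod A B \<Longrightarrow> \<Theta> \<rhd> \<Gamma> \<turnstile> Pair (Pr1 M) (Pr2 M) \<approx> M \<Colon> Prod A B"
| e_do_beta: "\<Theta> \<rhd> \<Gamma> \<turnstile> M \<Colon> A \<Longrightarrow> \<Theta> \<rhd> A # \<Gamma> \<turnstile> N \<Colon> Mon X B
    \<Longrightarrow> \<Theta> \<rhd> \<Gamma> \<turnstile> Do X (Ret X M) N \<approx> inst N M \<Colon> Mon X B"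
| e_do_eta: "\<Theta> \<rhd> \<Gamma> \<turnstile> M \<Colon> Mon X A \<Longrightarrow> \<Theta> \<rhd> \<Gamma> \<turnstile> Do X M (Ret X (Var 0)) \<approx> M \<Colon> Mon X A"
| e_do_assoc: "\<Theta> \<rhd> \<Gamma> \<turnstile> M \<Colon> Mon X A \<Longrightarrow> \<Theta> \<rhd> A # \<Gamma> \<turnstile> N \<Colon> Mon X B \<Longrightarrow> \<Theta> \<rhd> B # \<Gamma> \<turnstile> P \<Colon> Mon X C
    \<Longrightarrow> \<Theta> \<rhd> \<Gamma> \<turnstile> Do X (Do X M N) P \<approx> Do X M (Do X N (ren P (up_ren Suc))) \<Colon> Mon X C"
| e_central: "\<Theta> \<rhd> \<Gamma> \<turnstile> M \<Colon> Mon MS A \<Longrightarrow> \<Theta> \<rhd> \<Gamma> \<turnstile> N \<Colon> Mon MT B \<Longrightarrow> \<Theta> \<rhd> B # A # \<Gamma> \<turnstile> P \<Colon> Mon MT C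
    \<Longrightarrow> \<Theta> \<rhd> \<Gamma> \<turnstile> Do MT (Iota M) (Do MT (lift N) P)
              \<approx> Do MT N (Do MT (lift (Iota M)) (swap_vars P)) \<Colon> Mon MT C"
| e_iota_inj: "\<Theta> \<rhd> \<Gamma> \<turnstile> Iota M \<approx> Iota N \<Colon> Mon MT A
    \<Longrightarrow> \<Theta> \<rhd> \<Gamma> \<turnstile> M \<Colon> Mon MS A \<Longrightarrow> \<Theta> \<rhd> \<Gamma> \<turnstile> N \<Colon> Mon MS A \<Longrightarrow> \<Theta> \<rhd> \<Gamma> \<turnstile> M \<approx> N \<Colon> Mon MS A"
| e_iota_do: "\<Theta> \<rhd> \<Gamma> \<turnstile> M \<Colon> Mon MS A \<Longrightarrow> \<Theta> \<rhd> A # \<Gamma> \<turnstile> N \<Colon> Mon MS B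
    \<Longrightarrow> \<Theta> \<rhd> \<Gamma> \<turnstile> Do MT (Iota M) (Iota N) \<approx> Iota (Do MS M N) \<Colon> Mon MT B"
| e_iota_ret: "\<Theta> \<rhd> \<Gamma> \<turnstile> M \<Colon> A \<Longrightarrow> \<Theta> \<rhd> \<Gamma> \<turnstile> Iota (Ret MS M) \<approx> Ret MT M \<Colon> Mon MT A"

locale csc_theory =
  fixes \<Theta> :: "('g, 'c) csc_presentation"
  assumes const_wf: "const_ty \<Theta> c = Some A \<Longrightarrow> wf_ty \<Theta> A"
    and ty_ax_wf: "(A, B) \<in> ty_ax \<Theta> \<Longrightarrow> wf_ty \<Theta> A \<and> wf_ty \<Theta> B"
    and tm_ax_wf: "(\<Gamma>, M, N, A) \<in> tm_ax \<Theta> \<Longrightarrow> \<Theta> \<rhd> \<Gamma> \<turnstile> M \<Colon> A \<and> \<Theta> \<rhd> \<Gamma> \<turnstile> N \<Colon> A"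


section \<open>Cartesian closed categories with chosen structure\<close>

record ('o, 'm) cat =
  obj :: "'o set"
  arr :: "'m set"
  src :: "'m \<Rightarrow> 'o"
  trg :: "'m \<Rightarrow> 'o"
  ide :: "'o \<Rightarrow> 'm"
  cmp :: "'m \<Rightarrow> 'm \<Rightarrow> 'm" (infixr "\<cdot>\<index>" 75)

definition hom :: "('o, 'm, 'z) cat_scheme \<Rightarrow> 'o \<Rightarrow> 'o \<Rightarrow> 'm set" where
  "hom C X Y = {f \<in> arr C. src C f = X \<and> trg C f = Y}"

locale category =
  fixes C :: "('o, 'm, 'z) cat_scheme" (structure)
  assumes src_obj: "f \<in> arr C \<Longrightarrow> src C f \<in> obj C"
    and trg_obj: "f \<in> arr C \<Longrightarrow> trg C f \<in> obj C"
    and ide_hom: "X \<in> obj C \<Longrightarrow> ide C X \<in> hom C X X"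
    and cmp_hom: "f \<in> hom C X Y \<Longrightarrow> g \<in> hom C Y Z \<Longrightarrow> g \<cdot> f \<in> hom C X Z"
    and cmp_ide: "f \<in> hom C X Y \<Longrightarrow> f \<cdot> ide C X = f"
    and ide_cmp: "f \<in> hom C X Y \<Longrightarrow> ide C Y \<cdot> f = f"
    and cmp_assoc: "f \<in> hom C W X \<Longrightarrow> g \<in> hom C X Y \<Longrightarrow> h \<in> hom C Y Z
      \<Longrightarrow> (h \<cdot> g) \<cdot> f = h \<cdot> (g \<cdot> f)"

text \<open>
  \<open>expo C X Y\<close> is the exponential \<open>Y\<^sup>X\<close>, with evaluation \<open>ev C X Y : Y\<^sup>X \<times> X \<rightarrow> Y\<close>.
\<close>

record ('o, 'm) ccc = "('o, 'm) cat" +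
  one :: 'o
  prd :: "'o \<Rightarrow> 'o \<Rightarrow> 'o" (infixr "\<otimes>\<index>" 80)
  proj1 :: "'o \<Rightarrow> 'o \<Rightarrow> 'm"
  proj2 :: "'o \<Rightarrow> 'o \<Rightarrow> 'm"
  expo :: "'o \<Rightarrow> 'o \<Rightarrow> 'o"
  ev :: "'o \<Rightarrow> 'o \<Rightarrow> 'm"

definition bang :: "('o, 'm, 'z) ccc_scheme \<Rightarrow> 'o \<Rightarrow> 'm" where
  "bang C X = (THE f. f \<in> hom C X (one C))"

definition tuple :: "('o, 'm, 'z) ccc_scheme \<Rightarrow> 'm \<Rightarrow> 'm \<Rightarrow> 'm" ("\<langle>_, _\<rangle>\<index>") where
  "tuple C f g = (THE h. h \<in> hom C (src C f) (trg C f \<otimes>\<^bsub>C\<^esub> trg C g)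
     \<and> proj1 C (trg C f) (trg C g) \<cdot>\<^bsub>C\<^esub> h = f \<and> proj2 C (trg C f) (trg C g) \<cdot>\<^bsub>C\<^esub> h = g)"

definition prod_arr :: "('o, 'm, 'z) ccc_scheme \<Rightarrow> 'm \<Rightarrow> 'm \<Rightarrow> 'm" (infixr "\<otimes>\<^sub>m\<index>" 80) where
  "prod_arr C f g = \<langle>f \<cdot>\<^bsub>C\<^esub> proj1 C (src C f) (src C g), g \<cdot>\<^bsub>C\<^esub> proj2 C (src C f) (src C g)\<rangle>\<^bsub>C\<^esub>"

definition curry_arr :: "('o, 'm, 'z) ccc_scheme \<Rightarrow> 'o \<Rightarrow> 'o \<Rightarrow> 'm \<Rightarrow> 'm" where
  "curry_arr C Z X f = (THE g. g \<in> hom C Z (expo C X (trg C f))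
     \<and> ev C X (trg C f) \<cdot>\<^bsub>C\<^esub> (g \<otimes>\<^sub>m\<^bsub>C\<^esub> ide C X) = f)"

definition swap :: "('o, 'm, 'z) ccc_scheme \<Rightarrow> 'o \<Rightarrow> 'o \<Rightarrow> 'm" where
  "swap C X Y = \<langle>proj2 C X Y, proj1 C X Y\<rangle>\<^bsub>C\<^esub>"

definition assoc :: "('o, 'm, 'z) ccc_scheme \<Rightarrow> 'o \<Rightarrow> 'o \<Rightarrow> 'o \<Rightarrow> 'm" where
  "assoc C X Y Z = \<langle>proj1 C X Y \<cdot>\<^bsub>C\<^esub> proj1 C (X \<otimes>\<^bsub>C\<^esub> Y) Z,
     \<langle>proj2 C X Y \<cdot>\<^bsub>C\<^esub> proj1 C (X \<otimes>\<^bsub>C\<^esub> Y) Z, proj2 C (X \<otimes>\<^bsub>C\<^esub> Y) Z\<rangle>\<^bsub>C\<^esub>\<rangle>\<^bsub>C\<^esub>"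

locale cartesian_closed = category C for C :: "('o, 'm, 'z) ccc_scheme" (structure) +
  assumes one_obj: "one C \<in> obj C"
    and terminal: "X \<in> obj C \<Longrightarrow> \<exists>!f. f \<in> hom C X (one C)"
    and prd_obj: "X \<in> obj C \<Longrightarrow> Y \<in> obj C \<Longrightarrow> X \<otimes> Y \<in> obj C"
    and proj1_hom: "X \<in> obj C \<Longrightarrow> Y \<in> obj C \<Longrightarrow> proj1 C X Y \<in> hom C (X \<otimes> Y) X"
    and proj2_hom: "X \<in> obj C \<Longrightarrow> Y \<in> obj C \<Longrightarrow> proj2 C X Y \<in> hom C (X \<otimes> Y) Y"
    and product: "f \<in> hom C Z X \<Longrightarrow> g \<in> hom C Z Y
      \<Longrightarrow> \<exists>!h. h \<in> hom C Z (X \<otimes> Y) \<and> proj1 C X Y \<cdot> h = f \<and> proj2 C X Y \<cdot> h = g"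
    and expo_obj: "X \<in> obj C \<Longrightarrow> Y \<in> obj C \<Longrightarrow> expo C X Y \<in> obj C"
    and ev_hom: "X \<in> obj C \<Longrightarrow> Y \<in> obj C \<Longrightarrow> ev C X Y \<in> hom C (expo C X Y \<otimes> X) Y"
    and exponential: "Z \<in> obj C \<Longrightarrow> X \<in> obj C \<Longrightarrow> f \<in> hom C (Z \<otimes> X) Y
      \<Longrightarrow> \<exists>!g. g \<in> hom C Z (expo C X Y) \<and> ev C X Y \<cdot> (g \<otimes>\<^sub>m ide C X) = f"


section \<open>Strong monads and central submonads\<close>

text \<open>\<open>str T X Y\<close> is the (left) strength \<open>X \<times> T Y \<rightarrow> T (X \<times> Y)\<close>.\<close>

record ('o, 'm) monad =
  fob :: "'o \<Rightarrow> 'o"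
  far :: "'m \<Rightarrow> 'm"
  unit :: "'o \<Rightarrow> 'm"
  mult :: "'o \<Rightarrow> 'm"
  str :: "'o \<Rightarrow> 'o \<Rightarrow> 'm"

locale strong_monad = cartesian_closed C for C :: "('o, 'm, 'z) ccc_scheme" (structure) +
  fixes T :: "('o, 'm) monad"
  assumes fob_obj: "X \<in> obj C \<Longrightarrow> fob T X \<in> obj C"
    and far_hom: "f \<in> hom C X Y \<Longrightarrow> far T f \<in> hom C (fob T X) (fob T Y)"
    and far_ide: "X \<in> obj C \<Longrightarrow> far T (ide C X) = ide C (fob T X)"
    and far_cmp: "f \<in> hom C X Y \<Longrightarrow> g \<in> hom C Y Z \<Longrightarrow> far T (g \<cdot> f) = far T g \<cdot> far T f"
    and unit_hom: "X \<in> obj C \<Longrightarrow> unit T X \<in> hom C X (fob T X)"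
    and unit_nat: "f \<in> hom C X Y \<Longrightarrow> far T f \<cdot> unit T X = unit T Y \<cdot> f"
    and mult_hom: "X \<in> obj C \<Longrightarrow> mult T X \<in> hom C (fob T (fob T X)) (fob T X)"
    and mult_nat: "f \<in> hom C X Y \<Longrightarrow> far T f \<cdot> mult T X = mult T Y \<cdot> far T (far T f)"
    and mult_unit: "X \<in> obj C \<Longrightarrow> mult T X \<cdot> unit T (fob T X) = ide C (fob T X)"
    and mult_far_unit: "X \<in> obj C \<Longrightarrow> mult T X \<cdot> far T (unit T X) = ide C (fob T X)"
    and mult_mult: "X \<in> obj C \<Longrightarrow> mult T X \<cdot> mult T (fob T X) = mult T X \<cdot> far T (mult T X)"
    and str_hom: "X \<in> obj C \<Longrightarrow> Y \<in> obj C \<Longrightarrow> str T X Y \<in> hom C (X \<otimes> fob T Y) (fob T (X \<otimes> Y))"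
    and str_nat: "f \<in> hom C X X' \<Longrightarrow> g \<in> hom C Y Y'
      \<Longrightarrow> far T (f \<otimes>\<^sub>m g) \<cdot> str T X Y = str T X' Y' \<cdot> (f \<otimes>\<^sub>m far T g)"
    and str_one: "X \<in> obj C
      \<Longrightarrow> far T (proj2 C (one C) X) \<cdot> str T (one C) X = proj2 C (one C) (fob T X)"
    and str_assoc: "X \<in> obj C \<Longrightarrow> Y \<in> obj C \<Longrightarrow> Z \<in> obj C
      \<Longrightarrow> far T (assoc C X Y Z) \<cdot> str T (X \<otimes> Y) Z
        = str T X (Y \<otimes> Z) \<cdot> (ide C X \<otimes>\<^sub>m str T Y Z) \<cdot> assoc C X Y (fob T Z)"
    and str_unit: "X \<in> obj C \<Longrightarrow> Y \<in> obj C
      \<Longrightarrow> str T X Y \<cdot> (ide C X \<otimes>\<^sub>m unit T Y) = unit T (X \<otimes> Y)"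
    and str_mult: "X \<in> obj C \<Longrightarrow> Y \<in> obj C
      \<Longrightarrow> str T X Y \<cdot> (ide C X \<otimes>\<^sub>m mult T Y)
        = mult T (X \<otimes> Y) \<cdot> far T (str T X Y) \<cdot> str T X (fob T Y)"

definition right_str :: "('o, 'm, 'z) ccc_scheme \<Rightarrow> ('o, 'm) monad \<Rightarrow> 'o \<Rightarrow> 'o \<Rightarrow> 'm" where
  "right_str C T X Y = far T (swap C Y X) \<cdot>\<^bsub>C\<^esub> str T Y X \<cdot>\<^bsub>C\<^esub> swap C (fob T X) Y"

locale strong_monad_morphism = S: strong_monad C S + T: strong_monad C T
  for C :: "('o, 'm, 'z) ccc_scheme" (structure) and S T +
  fixes \<iota> :: "'o \<Rightarrow> 'm"
  assumes morph_hom: "X \<in> obj C \<Longrightarrow> \<iota> X \<in> hom C (fob S X) (fob T X)"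
    and morph_nat: "f \<in> hom C X Y \<Longrightarrow> far T f \<cdot> \<iota> X = \<iota> Y \<cdot> far S f"
    and morph_unit: "X \<in> obj C \<Longrightarrow> \<iota> X \<cdot> unit S X = unit T X"
    and morph_mult: "X \<in> obj C \<Longrightarrow> \<iota> X \<cdot> mult S X = mult T X \<cdot> far T (\<iota> X) \<cdot> \<iota> (fob S X)"
    and morph_str: "X \<in> obj C \<Longrightarrow> Y \<in> obj C
      \<Longrightarrow> \<iota> (X \<otimes> Y) \<cdot> str S X Y = str T X Y \<cdot> (ide C X \<otimes>\<^sub>m \<iota> Y)"

definition monic :: "('o, 'm, 'z) cat_scheme \<Rightarrow> 'm \<Rightarrow> bool" where
  "monic C m \<longleftrightarrow> m \<in> arr C \<and> (\<forall>Z f g. f \<in> hom C Z (src C m) \<longrightarrow> g \<in> hom C Z (src C m)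
     \<longrightarrow> m \<cdot>\<^bsub>C\<^esub> f = m \<cdot>\<^bsub>C\<^esub> g \<longrightarrow> f = g)"

locale strong_submonad = strong_monad_morphism +
  assumes morph_monic: "X \<in> obj C \<Longrightarrow> monic C (\<iota> X)"

text \<open>
  In particular the inclusion is a monomorphism in the category of strong monads over \<open>C\<close>.
\<close>

lemma (in strong_submonad) monic_strong_monad_morphism:
  assumes "strong_monad_morphism C R S \<alpha>" and "strong_monad_morphism C R S \<beta>"
    and "\<And>X. X \<in> obj C \<Longrightarrow> \<iota> X \<cdot> \<alpha> X = \<iota> X \<cdot> \<beta> X"
    and "X \<in> obj C"
  shows "\<alpha> X = \<beta> X"
proof -
  have "src C (\<iota> X) = fob S X"
    using morph_hom[OF assms(4)] by (simp add: hom_def)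
  moreover have "\<alpha> X \<in> hom C (fob R X) (fob S X)" "\<beta> X \<in> hom C (fob R X) (fob S X)"
    using strong_monad_morphism.morph_hom[OF _ assms(4)] assms(1,2) by blast+
  ultimately show ?thesis
    using morph_monic[OF assms(4)] assms(3)[OF assms(4)] unfolding monic_def by metis
qed

definition central_cone :: "('o, 'm, 'z) ccc_scheme \<Rightarrow> ('o, 'm) monad \<Rightarrow> 'o \<Rightarrow> 'o \<Rightarrow> 'm \<Rightarrow> bool" where
  "central_cone C T X Z f \<longleftrightarrow> f \<in> hom C Z (fob T X) \<and> (\<forall>Y \<in> obj C.
     mult T (X \<otimes>\<^bsub>C\<^esub> Y) \<cdot>\<^bsub>C\<^esub> far T (right_str C T X Y) \<cdot>\<^bsub>C\<^esub> str T (fob T X) Y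
       \<cdot>\<^bsub>C\<^esub> (f \<otimes>\<^sub>m\<^bsub>C\<^esub> ide C (fob T Y))
     = mult T (X \<otimes>\<^bsub>C\<^esub> Y) \<cdot>\<^bsub>C\<^esub> far T (str T X Y) \<cdot>\<^bsub>C\<^esub> right_str C T X (fob T Y)
       \<cdot>\<^bsub>C\<^esub> (f \<otimes>\<^sub>m\<^bsub>C\<^esub> ide C (fob T Y)))"

locale central_submonad = strong_submonad +
  assumes central: "X \<in> obj C \<Longrightarrow> central_cone C T X (fob S X) (\<iota> X)"

definition csc_model ::
    "('o, 'm, 'z) ccc_scheme \<Rightarrow> ('o, 'm) monad \<Rightarrow> ('o, 'm) monad \<Rightarrow> ('o \<Rightarrow> 'm) \<Rightarrow> bool" where
  "csc_model C T S \<iota> \<longleftrightarrow> cartesian_closed C \<and> strong_monad C T \<and> central_submonad C S T \<iota>"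


section \<open>Interpretations\<close>

primrec ctx_obj :: "('o, 'm, 'z) ccc_scheme \<Rightarrow> ('g ty \<Rightarrow> 'o) \<Rightarrow> 'g ctx \<Rightarrow> 'o" where
  "ctx_obj C I [] = one C"
| "ctx_obj C I (A # \<Gamma>) = ctx_obj C I \<Gamma> \<otimes>\<^bsub>C\<^esub> I A"

primrec ctx_proj :: "('o, 'm, 'z) ccc_scheme \<Rightarrow> ('g ty \<Rightarrow> 'o) \<Rightarrow> 'g ctx \<Rightarrow> nat \<Rightarrow> 'm" where
  "ctx_proj C I [] n = undefined"
| "ctx_proj C I (A # \<Gamma>) n = (case n of
      0 \<Rightarrow> proj2 C (ctx_obj C I \<Gamma>) (I A)
    | Suc k \<Rightarrow> ctx_proj C I \<Gamma> k \<cdot>\<^bsub>C\<^esub> proj1 C (ctx_obj C I \<Gamma>) (I A))"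

text \<open>
  An interpretation consists of a map \<open>I\<close> on types and a map \<open>J\<close> on typed judgements, \<open>J \<Gamma> M A\<close>
  being the interpretation of \<open>\<Gamma> \<turnstile> M : A\<close>. As typing is only unique up to type equality, the
  clauses quantify over all typings of the immediate subterms.
\<close>

locale csc_interpretation = csc_theory \<Theta>
  for \<Theta> :: "('g, 'c) csc_presentation" +
  fixes C :: "('o, 'm, 'z) ccc_scheme" (structure)
    and T S :: "('o, 'm) monad" and \<iota> :: "'o \<Rightarrow> 'm"
    and I :: "'g ty \<Rightarrow> 'o" and J :: "'g ctx \<Rightarrow> ('g, 'c) tm \<Rightarrow> 'g ty \<Rightarrow> 'm"
  assumes model: "csc_model C T S \<iota>"
    and i_ground: "G \<in> ground \<Theta> \<Longrightarrow> I (Ground G) \<in> obj C"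
    and i_unit: "I Unit = one C"
    and i_fun: "wf_ty \<Theta> A \<Longrightarrow> wf_ty \<Theta> B \<Longrightarrow> I (Fun A B) = expo C (I A) (I B)"
    and i_prod: "wf_ty \<Theta> A \<Longrightarrow> wf_ty \<Theta> B \<Longrightarrow> I (Prod A B) = I A \<otimes> I B"
    and i_mon: "wf_ty \<Theta> A \<Longrightarrow> I (Mon X A) = fob (case X of MS \<Rightarrow> S | MT \<Rightarrow> T) (I A)"
    and j_hom: "\<Theta> \<rhd> \<Gamma> \<turnstile> M \<Colon> A \<Longrightarrow> J \<Gamma> M A \<in> hom C (ctx_obj C I \<Gamma>) (I A)"
    and j_conv: "\<Theta> \<rhd> \<Gamma> \<turnstile> M \<Colon> A \<Longrightarrow> \<Theta> \<rhd>\<^sub>t A \<approx> B \<Longrightarrow> J \<Gamma> M B = J \<Gamma> M A"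
    and j_var: "wf_ctx \<Theta> \<Gamma> \<Longrightarrow> n < length \<Gamma> \<Longrightarrow> J \<Gamma> (Var n) (\<Gamma> ! n) = ctx_proj C I \<Gamma> n"
    and j_const: "wf_ctx \<Theta> \<Gamma> \<Longrightarrow> const_ty \<Theta> c = Some A
      \<Longrightarrow> J \<Gamma> (Const c) A = J [] (Const c) A \<cdot> bang C (ctx_obj C I \<Gamma>)"
    and j_star: "wf_ctx \<Theta> \<Gamma> \<Longrightarrow> J \<Gamma> Star Unit = bang C (ctx_obj C I \<Gamma>)"
    and j_lam: "\<Theta> \<rhd> A # \<Gamma> \<turnstile> M \<Colon> B
      \<Longrightarrow> J \<Gamma> (Lam A M) (Fun A B) = curry_arr C (ctx_obj C I \<Gamma>) (I A) (J (A # \<Gamma>) M B)"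
    and j_app: "\<Theta> \<rhd> \<Gamma> \<turnstile> M \<Colon> Fun A B \<Longrightarrow> \<Theta> \<rhd> \<Gamma> \<turnstile> N \<Colon> A
      \<Longrightarrow> J \<Gamma> (App M N) B = ev C (I A) (I B) \<cdot> \<langle>J \<Gamma> M (Fun A B), J \<Gamma> N A\<rangle>"
    and j_pair: "\<Theta> \<rhd> \<Gamma> \<turnstile> M \<Colon> A \<Longrightarrow> \<Theta> \<rhd> \<Gamma> \<turnstile> N \<Colon> B
      \<Longrightarrow> J \<Gamma> (Pair M N) (Prod A B) = \<langle>J \<Gamma> M A, J \<Gamma> N B\<rangle>"
    and j_pr1: "\<Theta> \<rhd> \<Gamma> \<turnstile> M \<Colon> Prod A B
      \<Longrightarrow> J \<Gamma> (Pr1 M) A = proj1 C (I A) (I B) \<cdot> J \<Gamma> M (Prod A B)"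
    and j_pr2: "\<Theta> \<rhd> \<Gamma> \<turnstile> M \<Colon> Prod A B
      \<Longrightarrow> J \<Gamma> (Pr2 M) B = proj2 C (I A) (I B) \<cdot> J \<Gamma> M (Prod A B)"
    and j_ret: "\<Theta> \<rhd> \<Gamma> \<turnstile> M \<Colon> A
      \<Longrightarrow> J \<Gamma> (Ret X M) (Mon X A) = unit (case X of MS \<Rightarrow> S | MT \<Rightarrow> T) (I A) \<cdot> J \<Gamma> M A"
    and j_iota: "\<Theta> \<rhd> \<Gamma> \<turnstile> M \<Colon> Mon MS A
      \<Longrightarrow> J \<Gamma> (Iota M) (Mon MT A) = \<iota> (I A) \<cdot> J \<Gamma> M (Mon MS A)"
    and j_do: "\<Theta> \<rhd> \<Gamma> \<turnstile> M \<Colon> Mon X A \<Longrightarrow> \<Theta> \<rhd> A # \<Gamma> \<turnstile> N \<Colon> Mon X B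
      \<Longrightarrow> R = (case X of MS \<Rightarrow> S | MT \<Rightarrow> T)
      \<Longrightarrow> J \<Gamma> (Do X M N) (Mon X B)
        = mult R (I B) \<cdot> far R (J (A # \<Gamma>) N (Mon X B)) \<cdot> str R (ctx_obj C I \<Gamma>) (I A)
          \<cdot> \<langle>ide C (ctx_obj C I \<Gamma>), J \<Gamma> M (Mon X A)\<rangle>"


section \<open>The syntactic model\<close>

type_synonym 'g cty = "'g ty set"

text \<open>A judgement \<open>x : A \<turnstile> f : B\<close> in one variable is encoded as the triple \<open>(A, f, B)\<close>.\<close>

type_synonym ('g, 'c) judgement = "'g ty \<times> ('g, 'c) tm \<times> 'g ty"
type_synonym ('g, 'c) ctm = "('g, 'c) judgement set"

definition ty_rel :: "('g, 'c) csc_presentation \<Rightarrow> ('g ty \<times> 'g ty) set" where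
  "ty_rel \<Theta> = {(A, B). \<Theta> \<rhd>\<^sub>t A \<approx> B}"

definition tm_rel :: "('g, 'c) csc_presentation \<Rightarrow> (('g, 'c) judgement \<times> ('g, 'c) judgement) set" where
  "tm_rel \<Theta> = {((A, f, B), (A', f', B')).
     \<Theta> \<rhd>\<^sub>t A \<approx> A' \<and> \<Theta> \<rhd>\<^sub>t B \<approx> B' \<and> \<Theta> \<rhd> [A] \<turnstile> f \<approx> f' \<Colon> B}"

definition ty_cls :: "('g, 'c) csc_presentation \<Rightarrow> 'g ty \<Rightarrow> 'g cty" where
  "ty_cls \<Theta> A = ty_rel \<Theta> `` {A}"

definition tm_cls :: "('g, 'c) csc_presentation \<Rightarrow> 'g ty \<Rightarrow> ('g, 'c) tm \<Rightarrow> 'g ty \<Rightarrow> ('g, 'c) ctm" where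
  "tm_cls \<Theta> A f B = tm_rel \<Theta> `` {(A, f, B)}"

text \<open>
  Operations on equivalence classes are defined on all representatives; the union merely
  extracts the common value.
\<close>

definition syn_cat :: "('g, 'c) csc_presentation \<Rightarrow> ('g cty, ('g, 'c) ctm) ccc" where
  "syn_cat \<Theta> = \<lparr>
     obj = {A. wf_ty \<Theta> A} // ty_rel \<Theta>,
     arr = {(A, f, B). \<Theta> \<rhd> [A] \<turnstile> f \<Colon> B} // tm_rel \<Theta>,
     src = (\<lambda>F. \<Union>(A, f, B) \<in> F. ty_cls \<Theta> A),
     trg = (\<lambda>F. \<Union>(A, f, B) \<in> F. ty_cls \<Theta> B),
     ide = (\<lambda>X. \<Union>A \<in> X. tm_cls \<Theta> A (Var 0) A),
     cmp = (\<lambda>G F. \<Union>(A, f, B) \<in> F. \<Union>(B', g, C) \<in> G. tm_cls \<Theta> A (inst g f) C),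
     one = ty_cls \<Theta> Unit,
     prd = (\<lambda>X Y. \<Union>A \<in> X. \<Union>B \<in> Y. ty_cls \<Theta> (Prod A B)),
     proj1 = (\<lambda>X Y. \<Union>A \<in> X. \<Union>B \<in> Y. tm_cls \<Theta> (Prod A B) (Pr1 (Var 0)) A),
     proj2 = (\<lambda>X Y. \<Union>A \<in> X. \<Union>B \<in> Y. tm_cls \<Theta> (Prod A B) (Pr2 (Var 0)) B),
     expo = (\<lambda>X Y. \<Union>A \<in> X. \<Union>B \<in> Y. ty_cls \<Theta> (Fun A B)),
     ev = (\<lambda>X Y. \<Union>A \<in> X. \<Union>B \<in> Y.
        tm_cls \<Theta> (Prod (Fun A B) A) (App (Pr1 (Var 0)) (Pr2 (Var 0))) B) \<rparr>"

text \<open>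
  Composition substitutes \<open>f\<close> for the only variable of \<open>g\<close>; \<open>inst g f\<close> is again a term over the
  variable of \<open>f\<close>. In \<open>far\<close>, the variable of \<open>f\<close> (index 0) becomes the variable bound by \<open>Do\<close>,
  i.e. \<open>X [x : A \<turnstile> f : B] = [y : X A \<turnstile> do x \<leftarrow> y; ret f : X B]\<close>.
\<close>

definition syn_monad :: "('g, 'c) csc_presentation \<Rightarrow> monad_sym \<Rightarrow> ('g cty, ('g, 'c) ctm) monad" where
  "syn_monad \<Theta> X = \<lparr>
     fob = (\<lambda>Y. \<Union>A \<in> Y. ty_cls \<Theta> (Mon X A)),
     far = (\<lambda>F. \<Union>(A, f, B) \<in> F. tm_cls \<Theta> (Mon X A) (Do X (Var 0) (Ret X f)) (Mon X B)),
     unit = (\<lambda>Y. \<Union>A \<in> Y. tm_cls \<Theta> A (Ret X (Var 0)) (Mon X A)),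
     mult = (\<lambda>Y. \<Union>A \<in> Y. tm_cls \<Theta> (Mon X (Mon X A)) (Do X (Var 0) (Var 0)) (Mon X A)),
     str = (\<lambda>Y Z. \<Union>A \<in> Y. \<Union>B \<in> Z.
        tm_cls \<Theta> (Prod A (Mon X B)) (Do X (Pr2 (Var 0)) (Ret X (Pair (Pr1 (Var 1)) (Var 0))))
          (Mon X (Prod A B))) \<rparr>"

definition syn_iota :: "('g, 'c) csc_presentation \<Rightarrow> 'g cty \<Rightarrow> ('g, 'c) ctm" where
  "syn_iota \<Theta> Y = (\<Union>A \<in> Y. tm_cls \<Theta> (Mon MS A) (Iota (Var 0)) (Mon MT A))"

text \<open>
  A context \<open>x\<^sub>1 : A\<^sub>1, \<dots>, x\<^sub>n : A\<^sub>n\<close> is packed into a single variable of type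
  \<open>((1 \<times> A\<^sub>1) \<times> \<dots>) \<times> A\<^sub>n\<close>, and \<open>\<Gamma> \<turnstile> M : A\<close> is sent to the class of \<open>M\<close> with the
  projections of that variable substituted for \<open>x\<^sub>1, \<dots>, x\<^sub>n\<close>.
\<close>

primrec ctx_ty :: "'g ctx \<Rightarrow> 'g ty" where
  "ctx_ty [] = Unit"
| "ctx_ty (A # \<Gamma>) = Prod (ctx_ty \<Gamma>) A"

definition canon_tm :: "('g, 'c) csc_presentation \<Rightarrow> 'g ctx \<Rightarrow> ('g, 'c) tm \<Rightarrow> 'g ty \<Rightarrow> ('g, 'c) ctm" where
  "canon_tm \<Theta> \<Gamma> M A = tm_cls \<Theta> (ctx_ty \<Gamma>) (sub M (\<lambda>n. Pr2 ((Pr1 ^^ n) (Var 0)))) A"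

end

(*
  Every object and arrow of the syntactic category is the class of a type or of a judgement in
  one variable, and every categorical operation acts on representatives by substitution. Each
  law thus reduces to one equation between two concrete terms in one variable; both sides are
  evaluated to a common form by beta, eta, the monad laws and the iota laws, and only centrality
  uses the commutation axiom. Completeness holds because packing a context into one variable is
  invertible up to provable equality: substituting the tuple of the variables for the packed
  variable turns each projection back into the variable it replaced.
*)

theory Submission
  imports Defs
begin

section \<open>Substitution\<close>

text \<open>The obstacle throughout is that the type axioms are arbitrary: \<open>Fun A B\<close>
  may equal \<open>Fun A' B'\<close> without equality of the components, so typings cannot be
  inverted. Hence arrows are always handled together with explicit source and target types, and the
  rules for computing with terms ask for typings of subterms. Arbitrary arrows raise a second
  difficulty, because an unknown term \<open>f\<close> blocks the computation of a substitution. As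
  \<open>f\<close> has a single variable, it is written \<open>inst f (Var 0)\<close>; every later
  substitution or renaming then acts on the argument alone, and \<open>f\<close> behaves like a
  unary function symbol, also under binders. Finally, the rules for equality contain neither
  simultaneous substitution nor conversion of the context. Both are derived before operations on
  classes can be shown to be independent of representatives.\<close>

lemma up_ren_simps [simp]: "up_ren r 0 = 0" "up_ren r (Suc n) = Suc (r n)"
  by (simp_all add: up_ren_def)

lemma up_sub_simps [simp]: "up_sub s 0 = Var 0" "up_sub s (Suc n) = lift (s n)"
  by (simp_all add: up_sub_def)

lemma up_ren_comp: "up_ren q \<circ> up_ren r = up_ren (q \<circ> r)"
  by (auto simp: up_ren_def fun_eq_iff split: nat.split)

lemma ren_ren: "ren (ren M r) q = ren M (q \<circ> r)"
  by (induction M arbitrary: r q) (simp_all add: up_ren_comp)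

lemma up_sub_up_ren: "up_sub s \<circ> up_ren r = up_sub (s \<circ> r)"
  by (auto simp: up_sub_def up_ren_def fun_eq_iff split: nat.split)

lemma sub_ren: "sub (ren M r) s = sub M (s \<circ> r)"
  by (induction M arbitrary: r s) (simp_all add: up_sub_up_ren)

lemma ren_up_sub: "(\<lambda>n. ren (up_sub s n) (up_ren r)) = up_sub (\<lambda>n. ren (s n) r)"
proof
  fix n
  show "ren (up_sub s n) (up_ren r) = up_sub (\<lambda>n. ren (s n) r) n"
    by (cases n) (simp_all add: ren_ren comp_def)
qed

lemma ren_sub: "ren (sub M s) r = sub M (\<lambda>n. ren (s n) r)"
  by (induction M arbitrary: r s) (simp_all add: ren_up_sub)

lemma sub_up_sub: "(\<lambda>n. sub (up_sub s n) (up_sub t)) = up_sub (\<lambda>n. sub (s n) t)"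
proof
  fix n
  show "sub (up_sub s n) (up_sub t) = up_sub (\<lambda>n. sub (s n) t) n"
    by (cases n) (simp_all add: sub_ren ren_sub comp_def)
qed

lemma sub_sub: "sub (sub M s) t = sub M (\<lambda>n. sub (s n) t)"
  by (induction M arbitrary: s t) (simp_all add: sub_up_sub)

lemma up_sub_Var: "up_sub Var = Var"
  by (auto simp: up_sub_def fun_eq_iff split: nat.split)

lemma sub_Var: "sub M Var = M"
  by (induction M) (simp_all add: up_sub_Var)

lemma up_sub_ren: "up_sub (\<lambda>n. Var (r n)) = (\<lambda>n. Var (up_ren r n))"
  by (auto simp: up_sub_def up_ren_def fun_eq_iff split: nat.split)

lemma ren_eq_sub: "ren M r = sub M (\<lambda>n. Var (r n))"
  by (induction M arbitrary: r) (simp_all add: up_sub_ren)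

text \<open>This is the shape of a beta contractum once a substitution has passed under the
  abstraction: both steps merge into one simultaneous substitution.\<close>

lemma inst_sub_up: "inst (sub M (up_sub s)) N = sub M (case_nat N s)"
proof -
  have "(\<lambda>n. sub (up_sub s n) (case_nat N Var)) = case_nat N s"
  proof
    fix n
    show "sub (up_sub s n) (case_nat N Var) = case_nat N s n"
      by (cases n) (simp_all add: sub_ren comp_def sub_Var)
  qed
  then show ?thesis
    by (simp add: inst_def sub_sub)
qed

lemma sub_inst: "sub (inst M N) s = sub M (case_nat (sub N s) s)"
proof -
  have "(\<lambda>n. sub (case_nat N Var n) s) = case_nat (sub N s) s"
    by (auto simp: fun_eq_iff split: nat.split)
  then show ?thesis
    by (simp add: inst_def sub_sub)
qed

text \<open>The substitution in \<open>inst\<close> changes its form under a binder, so the clauses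
  for \<open>Lam\<close> and \<open>Do\<close> fall back to \<open>sub\<close> with
  \<open>up_sub\<close>, which still computes on concrete bodies.\<close>

lemma inst_simps [simp]:
  "inst (Var 0) P = P"
  "inst (Var (Suc n)) P = Var n"
  "inst (Const c) P = Const c"
  "inst Star P = Star"
  "inst (Lam A M) P = Lam A (sub M (up_sub (case_nat P Var)))"
  "inst (App M N) P = App (inst M P) (inst N P)"
  "inst (Pair M N) P = Pair (inst M P) (inst N P)"
  "inst (Pr1 M) P = Pr1 (inst M P)"
  "inst (Pr2 M) P = Pr2 (inst M P)"
  "inst (Ret X M) P = Ret X (inst M P)"
  "inst (Iota M) P = Iota (inst M P)"
  "inst (Do X M N) P = Do X (inst M P) (sub N (up_sub (case_nat P Var)))"
  by (simp_all add: inst_def)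

section \<open>Structural properties of the judgements\<close>

lemma wf_ty_simps [simp]:
  "wf_ty \<Theta> (Ground G) \<longleftrightarrow> G \<in> ground \<Theta>"
  "wf_ty \<Theta> Unit"
  "wf_ty \<Theta> (Fun A B) \<longleftrightarrow> wf_ty \<Theta> A \<and> wf_ty \<Theta> B"
  "wf_ty \<Theta> (Prod A B) \<longleftrightarrow> wf_ty \<Theta> A \<and> wf_ty \<Theta> B"
  "wf_ty \<Theta> (Mon X A) \<longleftrightarrow> wf_ty \<Theta> A"
  by (auto simp: wf_ty_def)

lemma wf_ctx_simps [simp]:
  "wf_ctx \<Theta> []"
  "wf_ctx \<Theta> (A # \<Gamma>) \<longleftrightarrow> wf_ty \<Theta> A \<and> wf_ctx \<Theta> \<Gamma>"
  by (auto simp: wf_ctx_def)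

lemma wf_ctx_nth: "wf_ctx \<Theta> \<Gamma> \<Longrightarrow> n < length \<Gamma> \<Longrightarrow> wf_ty \<Theta> (\<Gamma> ! n)"
  by (simp add: wf_ctx_def)

lemma t_var0: "wf_ctx \<Theta> (A # \<Gamma>) \<Longrightarrow> \<Theta> \<rhd> A # \<Gamma> \<turnstile> Var 0 \<Colon> A"
  using t_var[of \<Theta> "A # \<Gamma>" 0] by simp

context csc_theory
begin

section \<open>Well-formedness, and closure of typing under renaming and substitution\<close>

lemma ty_eq_wf: "\<Theta> \<rhd>\<^sub>t A \<approx> B \<Longrightarrow> wf_ty \<Theta> A \<and> wf_ty \<Theta> B"
  by (induction rule: ty_eq.induct) (auto dest: ty_ax_wf)

lemma has_ty_wf: "\<Theta> \<rhd> \<Gamma> \<turnstile> M \<Colon> A \<Longrightarrow> wf_ctx \<Theta> \<Gamma> \<and> wf_ty \<Theta> A"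
  by (induction rule: has_ty.induct) (auto dest: const_wf ty_eq_wf wf_ctx_nth)

lemma has_ty_ren:
  assumes "\<Theta> \<rhd> \<Gamma> \<turnstile> M \<Colon> A" "wf_ctx \<Theta> \<Delta>"
    and "\<And>n. n < length \<Gamma> \<Longrightarrow> r n < length \<Delta> \<and> \<Delta> ! r n = \<Gamma> ! n"
  shows "\<Theta> \<rhd> \<Delta> \<turnstile> ren M r \<Colon> A"
  using assms
proof (induction arbitrary: \<Delta> r rule: has_ty.induct)
  case (t_var \<Gamma> n)
  then show ?case
    using has_ty.t_var[of \<Theta> \<Delta> "r n"] by auto
next
  case (t_lam A \<Gamma> M B)
  have "\<Theta> \<rhd> A # \<Delta> \<turnstile> ren M (up_ren r) \<Colon> B"
  proof (rule t_lam.IH)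
    show "wf_ctx \<Theta> (A # \<Delta>)"
      using t_lam.hyps t_lam.prems by (auto dest: has_ty_wf)
    show "up_ren r n < length (A # \<Delta>) \<and> (A # \<Delta>) ! up_ren r n = (A # \<Gamma>) ! n"
      if "n < length (A # \<Gamma>)" for n
      using that t_lam.prems by (cases n) auto
  qed
  then show ?case
    by (simp add: has_ty.t_lam)
next
  case (t_do \<Gamma> M X A N B)
  have "\<Theta> \<rhd> A # \<Delta> \<turnstile> ren N (up_ren r) \<Colon> Mon X B"
  proof (rule t_do.IH)
    show "wf_ctx \<Theta> (A # \<Delta>)"
      using t_do.hyps t_do.prems by (auto dest: has_ty_wf)
    show "up_ren r n < length (A # \<Delta>) \<and> (A # \<Delta>) ! up_ren r n = (A # \<Gamma>) ! n"
      if "n < length (A # \<Gamma>)" for n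
      using that t_do.prems by (cases n) auto
  qed
  moreover have "\<Theta> \<rhd> \<Delta> \<turnstile> ren M r \<Colon> Mon X A"
    using t_do.IH(1) t_do.prems by blast
  ultimately show ?case
    by (simp add: has_ty.t_do)
next
  case (t_app \<Gamma> M A B N)
  have "\<Theta> \<rhd> \<Delta> \<turnstile> ren M r \<Colon> Fun A B" "\<Theta> \<rhd> \<Delta> \<turnstile> ren N r \<Colon> A"
    using t_app.IH t_app.prems by blast+
  then show ?case
    by (simp add: has_ty.t_app)
next
  case (t_conv \<Gamma> M A B)
  then show ?case
    by (blast intro: has_ty.t_conv)
qed (auto intro: t_var t_const t_star t_app t_pair t_pr1 t_pr2 t_ret t_iota)

lemma has_ty_weak: "\<Theta> \<rhd> \<Gamma> \<turnstile> M \<Colon> A \<Longrightarrow> wf_ty \<Theta> B \<Longrightarrow> \<Theta> \<rhd> B # \<Gamma> \<turnstile> lift M \<Colon> A"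
  by (frule has_ty_wf, erule has_ty_ren) auto

lemma has_ty_up_sub:
  assumes "\<And>n. n < length \<Gamma> \<Longrightarrow> \<Theta> \<rhd> \<Delta> \<turnstile> s n \<Colon> \<Gamma> ! n" "wf_ctx \<Theta> (A # \<Delta>)"
    and "n < length (A # \<Gamma>)"
  shows "\<Theta> \<rhd> A # \<Delta> \<turnstile> up_sub s n \<Colon> (A # \<Gamma>) ! n"
  using assms by (cases n) (auto intro: t_var0 has_ty_weak)

lemma has_ty_sub:
  assumes "\<Theta> \<rhd> \<Gamma> \<turnstile> M \<Colon> A" "wf_ctx \<Theta> \<Delta>"
    and "\<And>n. n < length \<Gamma> \<Longrightarrow> \<Theta> \<rhd> \<Delta> \<turnstile> s n \<Colon> \<Gamma> ! n"
  shows "\<Theta> \<rhd> \<Delta> \<turnstile> sub M s \<Colon> A"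
  using assms
proof (induction arbitrary: \<Delta> s rule: has_ty.induct)
  case (t_lam A \<Gamma> M B)
  have "wf_ctx \<Theta> (A # \<Delta>)"
    using t_lam.hyps t_lam.prems by (auto dest: has_ty_wf)
  then have "\<Theta> \<rhd> A # \<Delta> \<turnstile> sub M (up_sub s) \<Colon> B"
    using t_lam.IH has_ty_up_sub t_lam.prems(2) by blast
  then show ?case
    by (simp add: has_ty.t_lam)
next
  case (t_do \<Gamma> M X A N B)
  have "wf_ctx \<Theta> (A # \<Delta>)"
    using t_do.hyps t_do.prems by (auto dest: has_ty_wf)
  then have "\<Theta> \<rhd> A # \<Delta> \<turnstile> sub N (up_sub s) \<Colon> Mon X B"
    using t_do.IH(2) has_ty_up_sub t_do.prems(2) by blast
  moreover have "\<Theta> \<rhd> \<Delta> \<turnstile> sub M s \<Colon> Mon X A"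
    using t_do.IH(1) t_do.prems by blast
  ultimately show ?case
    by (simp add: has_ty.t_do)
next
  case (t_app \<Gamma> M A B N)
  have "\<Theta> \<rhd> \<Delta> \<turnstile> sub M s \<Colon> Fun A B" "\<Theta> \<rhd> \<Delta> \<turnstile> sub N s \<Colon> A"
    using t_app.IH t_app.prems by blast+
  then show ?case
    by (simp add: has_ty.t_app)
next
  case (t_conv \<Gamma> M A B)
  then show ?case
    by (blast intro: has_ty.t_conv)
qed (auto intro: t_var t_const t_star t_app t_pair t_pr1 t_pr2 t_ret t_iota)

lemma has_ty_case_nat:
  assumes "\<Theta> \<rhd> \<Delta> \<turnstile> P \<Colon> A" "\<And>n. n < length \<Gamma> \<Longrightarrow> \<Theta> \<rhd> \<Delta> \<turnstile> s n \<Colon> \<Gamma> ! n"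
    and "n < length (A # \<Gamma>)"
  shows "\<Theta> \<rhd> \<Delta> \<turnstile> case_nat P s n \<Colon> (A # \<Gamma>) ! n"
  using assms by (cases n) auto

lemma has_ty_inst:
  assumes "\<Theta> \<rhd> A # \<Gamma> \<turnstile> M \<Colon> B" "\<Theta> \<rhd> \<Gamma> \<turnstile> P \<Colon> A"
  shows "\<Theta> \<rhd> \<Gamma> \<turnstile> inst M P \<Colon> B"
  unfolding inst_def using assms(1)
proof (rule has_ty_sub)
  show wf: "wf_ctx \<Theta> \<Gamma>"
    using assms has_ty_wf by blast
  show "\<Theta> \<rhd> \<Gamma> \<turnstile> case_nat P Var n \<Colon> (A # \<Gamma>) ! n" if "n < length (A # \<Gamma>)" for n
    using assms(2) t_var[OF wf] that by (rule has_ty_case_nat)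
qed

text \<open>The identity substitution does the work: index 0 is retyped by \<open>t_conv\<close>,
  all other variables keep their types.\<close>

lemma has_ty_conv_hd:
  assumes "\<Theta> \<rhd> A # \<Gamma> \<turnstile> M \<Colon> B" "\<Theta> \<rhd>\<^sub>t A \<approx> A'"
  shows "\<Theta> \<rhd> A' # \<Gamma> \<turnstile> M \<Colon> B"
proof -
  have wf: "wf_ctx \<Theta> (A' # \<Gamma>)"
    using assms by (auto dest: has_ty_wf ty_eq_wf)
  have "\<Theta> \<rhd> A' # \<Gamma> \<turnstile> Var n \<Colon> (A # \<Gamma>) ! n" if "n < length (A # \<Gamma>)" for n
  proof (cases n)
    case 0
    then show ?thesis
      using t_conv[OF t_var0[OF wf] ty_sym[OF assms(2)]] by simp
  next
    case (Suc m)
    then show ?thesis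
      using t_var[OF wf, of n] that by simp
  qed
  then show ?thesis
    using has_ty_sub[OF assms(1) wf, of Var] by (simp add: sub_Var)
qed

lemma has_ty_ren_up:
  assumes "\<Theta> \<rhd> B # \<Gamma> \<turnstile> P \<Colon> C" "wf_ty \<Theta> A"
  shows "\<Theta> \<rhd> B # A # \<Gamma> \<turnstile> ren P (up_ren Suc) \<Colon> C"
  using assms(1)
proof (rule has_ty_ren)
  show "wf_ctx \<Theta> (B # A # \<Gamma>)"
    using assms by (auto dest: has_ty_wf)
  show "up_ren Suc n < length (B # A # \<Gamma>) \<and> (B # A # \<Gamma>) ! up_ren Suc n = (B # \<Gamma>) ! n"
    if "n < length (B # \<Gamma>)" for n
    using that by (cases n) auto
qed

lemma has_ty_swap:
  assumes "\<Theta> \<rhd> B # A # \<Gamma> \<turnstile> P \<Colon> C"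
  shows "\<Theta> \<rhd> A # B # \<Gamma> \<turnstile> swap_vars P \<Colon> C"
  unfolding swap_vars_def using assms
proof (rule has_ty_ren)
  show "wf_ctx \<Theta> (A # B # \<Gamma>)"
    using has_ty_wf[OF assms] by simp
qed (auto simp: nth_Cons split: nat.splits)

section \<open>Equations relate typed terms and are closed under simultaneous substitution\<close>

lemma tm_eq_has_ty: "\<Theta> \<rhd> \<Gamma> \<turnstile> M \<approx> N \<Colon> A \<Longrightarrow> \<Theta> \<rhd> \<Gamma> \<turnstile> M \<Colon> A \<and> \<Theta> \<rhd> \<Gamma> \<turnstile> N \<Colon> A"
proof (induction rule: tm_eq.induct)
  case (e_axiom \<Gamma> M N A)
  then show ?case by (rule tm_ax_wf)
next
  case (e_lam A A' \<Gamma> M M' B)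
  \<comment> \<open>The annotation gives the right-hand side a type built from \<open>A'\<close>;
    conversion must bring it back to \<open>Fun A B\<close>, at which the rule states the
    equation.\<close>
  have "\<Theta> \<rhd> \<Gamma> \<turnstile> Lam A' M' \<Colon> Fun A' B"
    using e_lam has_ty_conv_hd t_lam by blast
  moreover have "\<Theta> \<rhd>\<^sub>t Fun A' B \<approx> Fun A B"
    using e_lam has_ty_wf by (blast intro: ty_fun ty_sym ty_refl)
  ultimately show ?case
    using e_lam t_lam t_conv by blast
next
  case (e_fun_eta \<Gamma> M A B)
  then have "wf_ctx \<Theta> (A # \<Gamma>)"
    using has_ty_wf by fastforce
  with e_fun_eta show ?case
    using has_ty_weak[OF e_fun_eta, of A] t_var0[of \<Theta> A \<Gamma>]
    by (auto intro: t_lam t_app)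
next
  case (e_do_eta \<Gamma> M X A)
  then have "wf_ctx \<Theta> (A # \<Gamma>)"
    using has_ty_wf by fastforce
  with e_do_eta show ?case
    using t_var0[of \<Theta> A \<Gamma>] by (auto intro: t_do t_ret)
next
  case (e_do_assoc \<Gamma> M X A N B P C)
  then have "wf_ty \<Theta> A"
    using has_ty_wf by fastforce
  with e_do_assoc show ?case
    using has_ty_ren_up by (blast intro: t_do)
next
  case (e_central \<Gamma> M A N B P C)
  then have wf: "wf_ty \<Theta> A" "wf_ty \<Theta> B"
    using has_ty_wf by fastforce+
  have "\<Theta> \<rhd> \<Gamma> \<turnstile> Do MT (Iota M) (Do MT (lift N) P) \<Colon> Mon MT C"
    using e_central wf has_ty_weak by (blast intro: t_do t_iota)
  moreover have "\<Theta> \<rhd> B # \<Gamma> \<turnstile> lift (Iota M) \<Colon> Mon MT A"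
    using e_central wf has_ty_weak t_iota by blast
  ultimately show ?case
    using e_central has_ty_swap by (blast intro: t_do)
next
  case (e_conv \<Gamma> M N A B)
  then show ?case
    by (blast intro: t_conv)
next
  case (e_unit_eta \<Gamma> M)
  then show ?case
    using has_ty_wf t_star by blast
next
  case (e_iota_do \<Gamma> M A N B)
  then show ?case
    by (blast intro: t_do t_iota)
qed (auto intro: t_star t_lam t_app t_pair t_pr1 t_pr2 t_ret t_iota t_do has_ty_weak has_ty_inst)

text \<open>Typing bounds the free variables by the length of the context. The extreme cases are
  what matters later: closed terms ignore substitutions, and terms over one variable see only the
  value at index 0.\<close>

lemma sub_cong_free:
  assumes "\<Theta> \<rhd> \<Gamma> \<turnstile> M \<Colon> A" "\<And>n. n < length \<Gamma> \<Longrightarrow> s n = t n"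
  shows "sub M s = sub M t"
  using assms
proof (induction arbitrary: s t rule: has_ty.induct)
  case (t_lam A \<Gamma> M B)
  have "up_sub s n = up_sub t n" if "n < length (A # \<Gamma>)" for n
    using that t_lam.prems by (cases n) auto
  then have "sub M (up_sub s) = sub M (up_sub t)"
    by (rule t_lam.IH)
  then show ?case
    by simp
next
  case (t_do \<Gamma> M X A N B)
  have "up_sub s n = up_sub t n" if "n < length (A # \<Gamma>)" for n
    using that t_do.prems by (cases n) auto
  then have "sub N (up_sub s) = sub N (up_sub t)"
    by (rule t_do.IH(2))
  moreover have "sub M s = sub M t"
    using t_do.prems by (rule t_do.IH(1))
  ultimately show ?case
    by simp
qed (((simp (no_asm))?; blast)+)

lemma sub_closed: "\<Theta> \<rhd> [] \<turnstile> M \<Colon> A \<Longrightarrow> sub M s = M"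
  using sub_cong_free[of "[]" M A s Var] by (simp add: sub_Var)

text \<open>Each use of \<open>e_weak\<close> lifts both terms, but lifting a closed term changes
  nothing, so no renaming accumulates.\<close>

lemma tm_eq_weak_closed:
  assumes "\<Theta> \<rhd> [] \<turnstile> M \<approx> N \<Colon> A" "wf_ctx \<Theta> \<Delta>"
  shows "\<Theta> \<rhd> \<Delta> \<turnstile> M \<approx> N \<Colon> A"
  using assms(2)
proof (induction \<Delta>)
  case Nil
  then show ?case using assms(1) by simp
next
  case (Cons B \<Delta>)
  have "lift M = M" "lift N = N"
    using tm_eq_has_ty[OF assms(1)] sub_closed by (auto simp: ren_eq_sub)
  with Cons show ?case
    using e_weak[of \<Theta> \<Delta> M N A B] by simp
qed

text \<open>
  The rules substitute only the last variable, and only in the same context. Abstracting over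
  the whole context, weakening the closed equation and applying it yields arbitrary
  simultaneous substitutions.
\<close>

lemma tm_eq_sub:
  assumes "\<Theta> \<rhd> \<Gamma> \<turnstile> M \<approx> N \<Colon> A" "wf_ctx \<Theta> \<Delta>"
    and "\<And>n. n < length \<Gamma> \<Longrightarrow> \<Theta> \<rhd> \<Delta> \<turnstile> s n \<Colon> \<Gamma> ! n"
  shows "\<Theta> \<rhd> \<Delta> \<turnstile> sub M s \<approx> sub N s \<Colon> A"
  using assms
proof (induction \<Gamma> arbitrary: M N A s)
  case Nil
  then show ?case
    using tm_eq_weak_closed tm_eq_has_ty[OF Nil(1)] sub_closed by auto
next
  case (Cons B \<Gamma>)
  define t where "t = (\<lambda>n. s (Suc n))"
  have s: "s = case_nat (s 0) t"
    by (auto simp: t_def fun_eq_iff split: nat.split)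
  have t: "\<Theta> \<rhd> \<Delta> \<turnstile> t n \<Colon> \<Gamma> ! n" if "n < length \<Gamma>" for n
    using Cons.prems(3)[of "Suc n"] that by (simp add: t_def)
  have s0: "\<Theta> \<rhd> \<Delta> \<turnstile> s 0 \<Colon> B"
    using Cons.prems(3)[of 0] by simp
  have wf: "wf_ctx \<Theta> (B # \<Delta>)" and B: "wf_ty \<Theta> B"
    using Cons.prems(2) s0 by (auto dest: has_ty_wf)
  have ty: "\<Theta> \<rhd> B # \<Delta> \<turnstile> sub M (up_sub t) \<Colon> A" "\<Theta> \<rhd> B # \<Delta> \<turnstile> sub N (up_sub t) \<Colon> A"
    using tm_eq_has_ty[OF Cons.prems(1)] has_ty_sub[OF _ wf has_ty_up_sub[OF t wf]] by blast+
  have "\<Theta> \<rhd> \<Gamma> \<turnstile> Lam B M \<approx> Lam B N \<Colon> Fun B A"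
    using Cons.prems(1) B by (blast intro: e_lam ty_refl)
  then have "\<Theta> \<rhd> \<Delta> \<turnstile> sub (Lam B M) t \<approx> sub (Lam B N) t \<Colon> Fun B A"
    using Cons.IH Cons.prems(2) t by blast
  then have "\<Theta> \<rhd> \<Delta> \<turnstile> App (Lam B (sub M (up_sub t))) (s 0) \<approx> App (Lam B (sub N (up_sub t))) (s 0) \<Colon> A"
    using e_app e_refl[OF s0] by fastforce
  moreover have "\<Theta> \<rhd> \<Delta> \<turnstile> App (Lam B (sub M (up_sub t))) (s 0) \<approx> sub M s \<Colon> A"
    using e_fun_beta[OF ty(1) s0] s by (simp add: inst_sub_up)
  moreover have "\<Theta> \<rhd> \<Delta> \<turnstile> App (Lam B (sub N (up_sub t))) (s 0) \<approx> sub N s \<Colon> A"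
    using e_fun_beta[OF ty(2) s0] s by (simp add: inst_sub_up)
  ultimately show ?case
    by (blast intro: e_trans e_sym)
qed

text \<open>Again by the identity substitution, whose variables are retyped in the converted
  context.\<close>

lemma tm_eq_ctx_conv_hd:
  assumes "\<Theta> \<rhd> A # \<Gamma> \<turnstile> M \<approx> N \<Colon> B" "\<Theta> \<rhd>\<^sub>t A \<approx> A'"
  shows "\<Theta> \<rhd> A' # \<Gamma> \<turnstile> M \<approx> N \<Colon> B"
proof -
  have wf: "wf_ctx \<Theta> (A' # \<Gamma>)" "wf_ctx \<Theta> (A # \<Gamma>)"
    using assms by (auto dest!: tm_eq_has_ty dest: has_ty_wf ty_eq_wf)
  have "\<Theta> \<rhd> A' # \<Gamma> \<turnstile> Var n \<Colon> (A # \<Gamma>) ! n" if "n < length (A # \<Gamma>)" for n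
    using has_ty_conv_hd[OF t_var[OF wf(2) that] assms(2)] .
  then show ?thesis
    using tm_eq_sub[OF assms(1) wf(1), of Var] by (simp add: sub_Var)
qed

text \<open>Complements \<open>tm_eq_sub\<close>: there the term substituted into varies, here the
  terms substituted do. The induction is on the typing, since only one fixed term is traversed;
  \<open>e_weak\<close> carries the hypotheses under binders.\<close>

lemma sub_cong:
  assumes "\<Theta> \<rhd> \<Gamma> \<turnstile> M \<Colon> A" "wf_ctx \<Theta> \<Delta>"
    and "\<And>n. n < length \<Gamma> \<Longrightarrow> \<Theta> \<rhd> \<Delta> \<turnstile> s n \<approx> t n \<Colon> \<Gamma> ! n"
  shows "\<Theta> \<rhd> \<Delta> \<turnstile> sub M s \<approx> sub M t \<Colon> A"
  using assms
proof (induction arbitrary: \<Delta> s t rule: has_ty.induct)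
  case (t_lam A \<Gamma> M B)
  have wf: "wf_ctx \<Theta> (A # \<Delta>)"
    using t_lam.hyps t_lam.prems by (auto dest: has_ty_wf)
  have "\<Theta> \<rhd> A # \<Delta> \<turnstile> up_sub s n \<approx> up_sub t n \<Colon> (A # \<Gamma>) ! n" if "n < length (A # \<Gamma>)" for n
    using that t_lam.prems wf e_refl[OF t_var0[OF wf]] by (cases n) (auto intro: e_weak)
  then have "\<Theta> \<rhd> A # \<Delta> \<turnstile> sub M (up_sub s) \<approx> sub M (up_sub t) \<Colon> B"
    using t_lam.IH wf by blast
  then show ?case
    using wf by (auto intro: e_lam ty_refl)
next
  case (t_do \<Gamma> M X A N B)
  have wf: "wf_ctx \<Theta> (A # \<Delta>)"
    using t_do.hyps t_do.prems by (auto dest: has_ty_wf)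
  have "\<Theta> \<rhd> A # \<Delta> \<turnstile> up_sub s n \<approx> up_sub t n \<Colon> (A # \<Gamma>) ! n" if "n < length (A # \<Gamma>)" for n
    using that t_do.prems wf e_refl[OF t_var0[OF wf]] by (cases n) (auto intro: e_weak)
  then have "\<Theta> \<rhd> A # \<Delta> \<turnstile> sub N (up_sub s) \<approx> sub N (up_sub t) \<Colon> Mon X B"
    using t_do.IH(2) wf by blast
  moreover have "\<Theta> \<rhd> \<Delta> \<turnstile> sub M s \<approx> sub M t \<Colon> Mon X A"
    using t_do.IH(1) t_do.prems by blast
  ultimately show ?case
    by (simp add: e_do)
next
  case (t_app \<Gamma> M A B N)
  have "\<Theta> \<rhd> \<Delta> \<turnstile> sub M s \<approx> sub M t \<Colon> Fun A B" "\<Theta> \<rhd> \<Delta> \<turnstile> sub N s \<approx> sub N t \<Colon> A"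
    using t_app.IH t_app.prems by blast+
  then show ?case
    by (simp add: e_app)
next
  case (t_conv \<Gamma> M A B)
  then show ?case
    by (blast intro: e_conv)
qed (auto intro: e_refl e_app e_pair e_pr1 e_pr2 e_ret e_iota t_const t_star)

section \<open>Equations in a single variable\<close>

text \<open>Together with \<open>t_var0\<close> this types a concrete index by peeling the context.
  The conclusion of \<open>t_var\<close> contains the lookup \<open>\<Gamma> ! n\<close>, which does
  not match a prescribed type.\<close>

lemma t_varS: "\<Theta> \<rhd> \<Gamma> \<turnstile> Var n \<Colon> A \<Longrightarrow> wf_ty \<Theta> B \<Longrightarrow> \<Theta> \<rhd> B # \<Gamma> \<turnstile> Var (Suc n) \<Colon> A"
  using has_ty_weak[of \<Gamma> "Var n"] by simp

lemma wf_intros: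
  "wf_ty \<Theta> Unit"
  "wf_ty \<Theta> A \<Longrightarrow> wf_ty \<Theta> B \<Longrightarrow> wf_ty \<Theta> (Fun A B)"
  "wf_ty \<Theta> A \<Longrightarrow> wf_ty \<Theta> B \<Longrightarrow> wf_ty \<Theta> (Prod A B)"
  "wf_ty \<Theta> A \<Longrightarrow> wf_ty \<Theta> (Mon X A)"
  "wf_ctx \<Theta> []"
  "wf_ty \<Theta> A \<Longrightarrow> wf_ctx \<Theta> \<Gamma> \<Longrightarrow> wf_ctx \<Theta> (A # \<Gamma>)"
  by auto

lemma inst_single_cong:
  assumes "\<Theta> \<rhd> [A] \<turnstile> f \<approx> g \<Colon> B" "\<Theta> \<rhd> \<Gamma> \<turnstile> t \<approx> u \<Colon> A"
  shows "\<Theta> \<rhd> \<Gamma> \<turnstile> inst f t \<approx> inst g u \<Colon> B"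
proof (rule e_trans)
  have wf: "wf_ctx \<Theta> \<Gamma>" and t: "\<Theta> \<rhd> \<Gamma> \<turnstile> t \<Colon> A" and g: "\<Theta> \<rhd> [A] \<turnstile> g \<Colon> B"
    using assms tm_eq_has_ty has_ty_wf by blast+
  show "\<Theta> \<rhd> \<Gamma> \<turnstile> inst f t \<approx> inst g t \<Colon> B"
    unfolding inst_def using assms(1) wf by (rule tm_eq_sub) (use t in simp)
  show "\<Theta> \<rhd> \<Gamma> \<turnstile> inst g t \<approx> inst g u \<Colon> B"
    unfolding inst_def using g wf by (rule sub_cong) (use assms(2) in simp)
qed

lemma ev_inst:
  "\<Theta> \<rhd> [A] \<turnstile> f \<Colon> B \<Longrightarrow> \<Theta> \<rhd> \<Gamma> \<turnstile> t \<approx> u \<Colon> A \<Longrightarrow> \<Theta> \<rhd> \<Gamma> \<turnstile> inst f t \<approx> inst f u \<Colon> B"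
  by (rule inst_single_cong[OF e_refl])

lemma t_inst: "\<Theta> \<rhd> [A] \<turnstile> f \<Colon> B \<Longrightarrow> \<Theta> \<rhd> \<Gamma> \<turnstile> t \<Colon> A \<Longrightarrow> \<Theta> \<rhd> \<Gamma> \<turnstile> inst f t \<Colon> B"
  using ev_inst[OF _ e_refl] tm_eq_has_ty by blast

lemma sub_single: "\<Theta> \<rhd> [A] \<turnstile> f \<Colon> B \<Longrightarrow> sub f s = inst f (s 0)"
  unfolding inst_def by (erule sub_cong_free) simp

text \<open>A term over one variable sees nothing but its argument, so substitutions and renamings
  slide past \<open>f\<close> onto \<open>t\<close>. These equations let the laws be computed with
  arbitrary arrows in them.\<close>

lemma single:
  assumes "\<Theta> \<rhd> [A] \<turnstile> f \<Colon> B"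
  shows "sub (inst f t) s = inst f (sub t s)"
    and "inst (inst f t) u = inst f (inst t u)"
    and "ren (inst f t) r = inst f (ren t r)"
proof -
  show sub: "sub (inst f t) s = inst f (sub t s)" for s
    using sub_single[OF assms] by (simp add: sub_inst)
  show "inst (inst f t) u = inst f (inst t u)"
    using sub by (simp add: inst_def)
  show "ren (inst f t) r = inst f (ren t r)"
    using sub by (simp add: ren_eq_sub)
qed

lemma inst_self: "\<Theta> \<rhd> [A] \<turnstile> f \<Colon> B \<Longrightarrow> inst f (Var 0) = f"
  using sub_single[of A f B Var] by (simp add: sub_Var)

text \<open>Here the new variables are older than the one of \<open>f\<close>, whereas
  \<open>e_weak\<close> adds a newer one; index 0 keeps its meaning and the terms are
  unchanged.\<close>

lemma tm_eq_weak_single: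
  assumes "\<Theta> \<rhd> [A] \<turnstile> f \<approx> g \<Colon> B" "wf_ctx \<Theta> \<Gamma>"
  shows "\<Theta> \<rhd> A # \<Gamma> \<turnstile> f \<approx> g \<Colon> B"
proof -
  have fg: "\<Theta> \<rhd> [A] \<turnstile> f \<Colon> B" "\<Theta> \<rhd> [A] \<turnstile> g \<Colon> B"
    using assms tm_eq_has_ty by blast+
  have "\<Theta> \<rhd> A # \<Gamma> \<turnstile> Var 0 \<Colon> A"
    using assms(2) has_ty_wf[OF fg(1)] by (auto intro: t_var0)
  then show ?thesis
    using inst_single_cong[OF assms(1) e_refl] inst_self fg by metis
qed

lemmas ty_intros = t_var0 t_varS t_star t_lam t_app t_pair t_pr1 t_pr2 t_ret t_iota t_do t_inst
  wf_intros


section \<open>Evaluation of terms by equational rules\<close>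

text \<open>
  Each of the following rules evaluates a term from left to right; the result may be left
  schematic. The typing premises on the subterms of the result are needed because distinct
  product types, say, may be equal without their components being equal, so that they do not
  follow from the typing of the term.
\<close>

lemma ev_join: "\<Theta> \<rhd> \<Gamma> \<turnstile> M \<approx> P \<Colon> A \<Longrightarrow> \<Theta> \<rhd> \<Gamma> \<turnstile> N \<approx> P \<Colon> A \<Longrightarrow> \<Theta> \<rhd> \<Gamma> \<turnstile> M \<approx> N \<Colon> A"
  by (blast intro: e_trans e_sym)

lemma ev_var: "\<Theta> \<rhd> \<Gamma> \<turnstile> Var n \<Colon> A \<Longrightarrow> \<Theta> \<rhd> \<Gamma> \<turnstile> Var n \<approx> Var n \<Colon> A"
  by (rule e_refl)

lemma ev_pr1:
  assumes "\<Theta> \<rhd> \<Gamma> \<turnstile> M \<approx> Pair N P \<Colon> Prod A B" "\<Theta> \<rhd> \<Gamma> \<turnstile> N \<Colon> A" "\<Theta> \<rhd> \<Gamma> \<turnstile> P \<Colon> B"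
  shows "\<Theta> \<rhd> \<Gamma> \<turnstile> Pr1 M \<approx> N \<Colon> A"
  using e_pr1[OF assms(1)] e_pr1_beta[OF assms(2,3)] by (rule e_trans)

lemma ev_pr2:
  assumes "\<Theta> \<rhd> \<Gamma> \<turnstile> M \<approx> Pair N P \<Colon> Prod A B" "\<Theta> \<rhd> \<Gamma> \<turnstile> N \<Colon> A" "\<Theta> \<rhd> \<Gamma> \<turnstile> P \<Colon> B"
  shows "\<Theta> \<rhd> \<Gamma> \<turnstile> Pr2 M \<approx> P \<Colon> B"
  using e_pr2[OF assms(1)] e_pr2_beta[OF assms(2,3)] by (rule e_trans)

text \<open>The contractum enters through the separate premise \<open>inst N P = Q\<close>, so that
  simplification can carry out the substitution before evaluation continues with
  \<open>Q\<close>.\<close>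

lemma ev_do_ret:
  assumes "\<Theta> \<rhd> \<Gamma> \<turnstile> M \<approx> Ret X P \<Colon> Mon X A" "\<Theta> \<rhd> \<Gamma> \<turnstile> P \<Colon> A" "\<Theta> \<rhd> A # \<Gamma> \<turnstile> N \<Colon> Mon X B"
    and "inst N P = Q" "\<Theta> \<rhd> \<Gamma> \<turnstile> Q \<approx> R \<Colon> Mon X B"
  shows "\<Theta> \<rhd> \<Gamma> \<turnstile> Do X M N \<approx> R \<Colon> Mon X B"
  using e_trans[OF e_do[OF assms(1) e_refl[OF assms(3)]] e_trans[OF e_do_beta[OF assms(2,3)]]]
    assms(4,5) by blast

lemma ev_do_do:
  assumes "\<Theta> \<rhd> \<Gamma> \<turnstile> M \<approx> Do X M1 M2 \<Colon> Mon X A" "\<Theta> \<rhd> \<Gamma> \<turnstile> M1 \<Colon> Mon X A1"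
    and "\<Theta> \<rhd> A1 # \<Gamma> \<turnstile> M2 \<Colon> Mon X A" "\<Theta> \<rhd> A # \<Gamma> \<turnstile> N \<Colon> Mon X B"
    and "ren N (up_ren Suc) = Q" "\<Theta> \<rhd> \<Gamma> \<turnstile> Do X M1 (Do X M2 Q) \<approx> R \<Colon> Mon X B"
  shows "\<Theta> \<rhd> \<Gamma> \<turnstile> Do X M N \<approx> R \<Colon> Mon X B"
  using e_trans[OF e_do[OF assms(1) e_refl[OF assms(4)]] e_trans[OF e_do_assoc[OF assms(2-4)]]]
    assms(5,6) by blast

lemma ev_do_eta:
  assumes "\<Theta> \<rhd> \<Gamma> \<turnstile> M \<approx> P \<Colon> Mon X A" "\<Theta> \<rhd> A # \<Gamma> \<turnstile> N \<approx> Ret X (Var 0) \<Colon> Mon X A"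
  shows "\<Theta> \<rhd> \<Gamma> \<turnstile> Do X M N \<approx> P \<Colon> Mon X A"
  using e_do[OF assms] e_do_eta assms(1) tm_eq_has_ty e_trans by blast

lemma ev_iota_ret:
  assumes "\<Theta> \<rhd> \<Gamma> \<turnstile> M \<approx> Ret MS P \<Colon> Mon MS A" "\<Theta> \<rhd> \<Gamma> \<turnstile> P \<Colon> A"
  shows "\<Theta> \<rhd> \<Gamma> \<turnstile> Iota M \<approx> Ret MT P \<Colon> Mon MT A"
  using e_iota[OF assms(1)] e_iota_ret[OF assms(2)] by (rule e_trans)

text \<open>The law is oriented so that \<open>Iota\<close> moves inwards: a \<open>Do MS\<close>
  under \<open>Iota\<close> turns into a \<open>Do MT\<close>, to which the laws of the larger monad
  apply.\<close>

lemma ev_iota_do: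
  assumes "\<Theta> \<rhd> \<Gamma> \<turnstile> M \<approx> Do MS M1 M2 \<Colon> Mon MS B" "\<Theta> \<rhd> \<Gamma> \<turnstile> M1 \<Colon> Mon MS A"
    and "\<Theta> \<rhd> A # \<Gamma> \<turnstile> M2 \<Colon> Mon MS B" "\<Theta> \<rhd> \<Gamma> \<turnstile> Do MT (Iota M1) (Iota M2) \<approx> R \<Colon> Mon MT B"
  shows "\<Theta> \<rhd> \<Gamma> \<turnstile> Iota M \<approx> R \<Colon> Mon MT B"
  using e_trans[OF e_iota[OF assms(1)] e_trans[OF e_sym[OF e_iota_do[OF assms(2,3)]] assms(4)]] .

text \<open>The order of the rules is that in which proof search tries them.\<close>

lemmas ev_rules = ev_var ev_pr1 e_pr1 ev_pr2 e_pr2 e_pair e_ret ev_do_ret ev_do_do ev_do_eta e_do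
  ev_iota_ret ev_iota_do e_iota ev_inst


section \<open>Equivalence classes\<close>

lemma mem_ty_cls: "B \<in> ty_cls \<Theta> A \<longleftrightarrow> \<Theta> \<rhd>\<^sub>t A \<approx> B"
  by (simp add: ty_cls_def ty_rel_def)

lemma mem_tm_cls:
  "(A', f', B') \<in> tm_cls \<Theta> A f B \<longleftrightarrow> \<Theta> \<rhd>\<^sub>t A \<approx> A' \<and> \<Theta> \<rhd>\<^sub>t B \<approx> B' \<and> \<Theta> \<rhd> [A] \<turnstile> f \<approx> f' \<Colon> B"
  by (simp add: tm_cls_def tm_rel_def)

lemma ty_cls_eq_iff: "wf_ty \<Theta> B \<Longrightarrow> ty_cls \<Theta> A = ty_cls \<Theta> B \<longleftrightarrow> \<Theta> \<rhd>\<^sub>t A \<approx> B"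
  by (auto simp: mem_ty_cls set_eq_iff intro: ty_refl ty_sym ty_trans)

text \<open>\<open>tm_rel\<close> states its equation at the types of the first judgement only.
  Transport along both type equations, in the context and in the result, makes the two classes
  coincide.\<close>

lemma tm_cls_cong:
  assumes A: "\<Theta> \<rhd>\<^sub>t A \<approx> A'" and B: "\<Theta> \<rhd>\<^sub>t B \<approx> B'" and f: "\<Theta> \<rhd> [A] \<turnstile> f \<approx> f' \<Colon> B"
  shows "tm_cls \<Theta> A f B = tm_cls \<Theta> A' f' B'"
proof -
  have f': "\<Theta> \<rhd> [A'] \<turnstile> f \<approx> f' \<Colon> B'"
    using tm_eq_ctx_conv_hd[OF e_conv[OF f B] A] .
  have "\<Theta> \<rhd> [A] \<turnstile> f \<approx> g \<Colon> B \<longleftrightarrow> \<Theta> \<rhd> [A'] \<turnstile> f' \<approx> g \<Colon> B'" for g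
  proof
    assume "\<Theta> \<rhd> [A] \<turnstile> f \<approx> g \<Colon> B"
    then have "\<Theta> \<rhd> [A'] \<turnstile> f \<approx> g \<Colon> B'"
      using A B by (blast intro: tm_eq_ctx_conv_hd e_conv)
    then show "\<Theta> \<rhd> [A'] \<turnstile> f' \<approx> g \<Colon> B'"
      using f' by (blast intro: e_sym e_trans)
  next
    assume "\<Theta> \<rhd> [A'] \<turnstile> f' \<approx> g \<Colon> B'"
    then have "\<Theta> \<rhd> [A] \<turnstile> f' \<approx> g \<Colon> B"
      using ty_sym[OF A] ty_sym[OF B] by (blast intro: tm_eq_ctx_conv_hd e_conv)
    then show "\<Theta> \<rhd> [A] \<turnstile> f \<approx> g \<Colon> B"
      using f by (blast intro: e_trans)
  qed
  moreover have "\<Theta> \<rhd>\<^sub>t A \<approx> D \<longleftrightarrow> \<Theta> \<rhd>\<^sub>t A' \<approx> D" "\<Theta> \<rhd>\<^sub>t B \<approx> D \<longleftrightarrow> \<Theta> \<rhd>\<^sub>t B' \<approx> D" for D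
    using A B by (blast intro: ty_sym ty_trans)+
  ultimately show ?thesis
    by (simp add: set_eq_iff split_paired_All mem_tm_cls)
qed

lemma tm_cls_eqD:
  assumes "tm_cls \<Theta> A f B = tm_cls \<Theta> A g B" "\<Theta> \<rhd> [A] \<turnstile> g \<Colon> B"
  shows "\<Theta> \<rhd> [A] \<turnstile> f \<approx> g \<Colon> B"
proof -
  have "(A, g, B) \<in> tm_cls \<Theta> A g B"
    using has_ty_wf[OF assms(2)] assms(2) by (auto simp: mem_tm_cls intro: ty_refl e_refl)
  then show ?thesis
    unfolding assms(1)[symmetric] by (simp add: mem_tm_cls)
qed

text \<open>Reflexivity makes the class nonempty; without that the union of a constant family would
  be empty rather than its value.\<close>

lemma UN_ty_cls:
  assumes "wf_ty \<Theta> A" "\<And>A'. \<Theta> \<rhd>\<^sub>t A \<approx> A' \<Longrightarrow> F A' = F A"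
  shows "(\<Union>A' \<in> ty_cls \<Theta> A. F A') = F A"
proof -
  have "ty_cls \<Theta> A \<noteq> {}"
    using ty_refl[OF assms(1)] by (auto simp: mem_ty_cls set_eq_iff)
  then show ?thesis
    by (rule SUP_eq_const) (use mem_ty_cls assms(2) in blast)
qed

lemma UN_ty_cls2:
  assumes A: "wf_ty \<Theta> A" and B: "wf_ty \<Theta> B"
    and F: "\<And>A' B'. \<Theta> \<rhd>\<^sub>t A \<approx> A' \<Longrightarrow> \<Theta> \<rhd>\<^sub>t B \<approx> B' \<Longrightarrow> F A' B' = F A B"
  shows "(\<Union>A' \<in> ty_cls \<Theta> A. \<Union>B' \<in> ty_cls \<Theta> B. F A' B') = F A B"
proof -
  have "(\<Union>B' \<in> ty_cls \<Theta> B. F A' B') = F A' B" if "\<Theta> \<rhd>\<^sub>t A \<approx> A'" for A'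
    \<comment> \<open>Constancy is assumed relative to the base point \<open>F A B\<close> only, so
      the two values at \<open>A'\<close> are compared through it.\<close>
    by (rule UN_ty_cls[OF B]) (rule trans[OF F[OF that] F[OF that, symmetric]], simp_all add: B ty_refl)
  then have "(\<Union>A' \<in> ty_cls \<Theta> A. \<Union>B' \<in> ty_cls \<Theta> B. F A' B') = (\<Union>A' \<in> ty_cls \<Theta> A. F A' B)"
    by (simp add: mem_ty_cls)
  also have "\<dots> = F A B"
    using ty_refl[OF B] F by (intro UN_ty_cls[OF A])
  finally show ?thesis .
qed

lemma UN_tm_cls:
  assumes "\<Theta> \<rhd> [A] \<turnstile> f \<Colon> B"
    and "\<And>A' f' B'. \<Theta> \<rhd>\<^sub>t A \<approx> A' \<Longrightarrow> \<Theta> \<rhd>\<^sub>t B \<approx> B' \<Longrightarrow> \<Theta> \<rhd> [A] \<turnstile> f \<approx> f' \<Colon> B \<Longrightarrow> F A' f' B' = F A f B"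
  shows "(\<Union>(A', f', B') \<in> tm_cls \<Theta> A f B. F A' f' B') = F A f B"
proof -
  have "(A, f, B) \<in> tm_cls \<Theta> A f B"
    using assms(1) has_ty_wf[OF assms(1)] by (auto simp: mem_tm_cls intro: ty_refl e_refl)
  then have "tm_cls \<Theta> A f B \<noteq> {}"
    by blast
  then show ?thesis
  proof (rule SUP_eq_const)
    fix x assume x: "x \<in> tm_cls \<Theta> A f B"
    obtain A' f' B' where "x = (A', f', B')"
      by (cases x)
    then show "(case x of (A', f', B') \<Rightarrow> F A' f' B') = F A f B"
      using x assms(2)[of A' B' f'] by (simp add: mem_tm_cls)
  qed
qed


section \<open>Representatives of objects and arrows\<close>

definition ob_rep :: "'g cty \<Rightarrow> 'g ty \<Rightarrow> bool" where
  "ob_rep Y A \<longleftrightarrow> wf_ty \<Theta> A \<and> Y = ty_cls \<Theta> A"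

text \<open>A relation rather than a choice of representative, because one arrow has to be presented
  at whatever equal types its neighbours in a composite prescribe.\<close>

definition rep :: "('g, 'c) ctm \<Rightarrow> 'g ty \<Rightarrow> ('g, 'c) tm \<Rightarrow> 'g ty \<Rightarrow> bool" where
  "rep F A f B \<longleftrightarrow> \<Theta> \<rhd> [A] \<turnstile> f \<Colon> B \<and> F = tm_cls \<Theta> A f B"

abbreviation SC where "SC \<equiv> syn_cat \<Theta>"
abbreviation SM where "SM \<equiv> syn_monad \<Theta>"

lemma rep_eqI: "rep F A f B \<Longrightarrow> rep G A g B \<Longrightarrow> \<Theta> \<rhd> [A] \<turnstile> f \<approx> g \<Colon> B \<Longrightarrow> F = G"
  using tm_cls_cong[OF ty_refl ty_refl] has_ty_wf[of "[A]" f B] by (simp add: rep_def)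

lemma rep_eqD: "rep F A f B \<Longrightarrow> rep F A g B \<Longrightarrow> \<Theta> \<rhd> [A] \<turnstile> f \<approx> g \<Colon> B"
  by (auto simp: rep_def intro: tm_cls_eqD)

lemma rep_unique: "rep F A f B \<Longrightarrow> rep G A f B \<Longrightarrow> F = G"
  by (simp add: rep_def)

lemma rep_cong: "rep F A f B \<Longrightarrow> \<Theta> \<rhd> [A] \<turnstile> f \<approx> g \<Colon> B \<Longrightarrow> rep F A g B"
  using tm_eq_has_ty rep_eqI[of F A f B "tm_cls \<Theta> A g B" g] by (auto simp: rep_def)

section \<open>Presenting objects and arrows at prescribed types\<close>

lemma obj_iff: "Y \<in> obj SC \<longleftrightarrow> (\<exists>A. ob_rep Y A)"
  by (auto simp: syn_cat_def ob_rep_def ty_cls_def quotient_def)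

lemma obj_rep: "ob_rep Y A \<Longrightarrow> Y \<in> obj SC"
  by (auto simp: obj_iff)

lemma arr_iff: "F \<in> arr SC \<longleftrightarrow> (\<exists>A f B. rep F A f B)"
  by (auto simp: syn_cat_def rep_def tm_cls_def quotient_def)

lemma rep_wf: "rep F A f B \<Longrightarrow> wf_ty \<Theta> A \<and> wf_ty \<Theta> B"
  by (auto simp: rep_def dest: has_ty_wf)

lemma ty_cls_eq: "\<Theta> \<rhd>\<^sub>t A \<approx> B \<Longrightarrow> ty_cls \<Theta> B = ty_cls \<Theta> A"
  using ty_eq_wf ty_cls_eq_iff by metis

lemma src_rep:
  assumes "rep F A f B"
  shows "src SC F = ty_cls \<Theta> A"
proof -
  have "src SC F = (\<Union>(A, f, B) \<in> tm_cls \<Theta> A f B. ty_cls \<Theta> A)"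
    using assms by (simp add: rep_def syn_cat_def)
  also have "\<dots> = ty_cls \<Theta> A"
    using assms by (intro UN_tm_cls ty_cls_eq) (auto simp: rep_def)
  finally show ?thesis .
qed

lemma trg_rep:
  assumes "rep F A f B"
  shows "trg SC F = ty_cls \<Theta> B"
proof -
  have "trg SC F = (\<Union>(A, f, B) \<in> tm_cls \<Theta> A f B. ty_cls \<Theta> B)"
    using assms by (simp add: rep_def syn_cat_def)
  also have "\<dots> = ty_cls \<Theta> B"
    using assms by (intro UN_tm_cls ty_cls_eq) (auto simp: rep_def)
  finally show ?thesis .
qed

lemma ob_src: "rep F A f B \<Longrightarrow> ob_rep (src SC F) A"
  using rep_wf src_rep by (auto simp: ob_rep_def)

lemma ob_trg: "rep F A f B \<Longrightarrow> ob_rep (trg SC F) B"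
  using rep_wf trg_rep by (auto simp: ob_rep_def)

lemma rep_hom: "rep F A f B \<Longrightarrow> ob_rep X A \<Longrightarrow> ob_rep Y B \<Longrightarrow> F \<in> hom SC X Y"
  using src_rep trg_rep by (auto simp: hom_def arr_iff ob_rep_def)

text \<open>Membership in \<open>hom\<close> fixes the types only up to type equality, so a
  representative is converted to the prescribed \<open>A\<close> and \<open>B\<close>. The form
  \<open>inst f (Var 0)\<close> is the one on which \<open>single\<close> and \<open>ev_inst\<close>
  act.\<close>

lemma hom_rep:
  assumes "F \<in> hom SC X Y" "ob_rep X A" "ob_rep Y B"
  obtains f where "\<Theta> \<rhd> [A] \<turnstile> f \<Colon> B" "rep F A (inst f (Var 0)) B"
proof -
  obtain A' f B' where r: "rep F A' f B'"
    using assms(1) by (auto simp: hom_def arr_iff)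
  have eq: "\<Theta> \<rhd>\<^sub>t A' \<approx> A" "\<Theta> \<rhd>\<^sub>t B' \<approx> B"
    using assms src_rep[OF r] trg_rep[OF r] ty_cls_eq_iff by (auto simp: hom_def ob_rep_def)
  have f: "\<Theta> \<rhd> [A] \<turnstile> f \<Colon> B"
    using r eq has_ty_conv_hd t_conv unfolding rep_def by blast
  moreover have "rep F A f B"
    using f r eq tm_cls_cong e_refl unfolding rep_def by blast
  ultimately show ?thesis
    using that inst_self[OF f] by simp
qed

lemma hom_rep_trg:
  assumes "F \<in> hom SC X Y" "ob_rep X A"
  obtains f B where "ob_rep Y B" "\<Theta> \<rhd> [A] \<turnstile> f \<Colon> B" "rep F A (inst f (Var 0)) B"
proof -
  obtain B where "ob_rep Y B"
    using assms(1) by (auto simp: hom_def arr_iff dest: ob_trg)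
  with assms show ?thesis
    using hom_rep that by blast
qed

lemma hom_rep_src:
  assumes "F \<in> hom SC X Y" "ob_rep Y B"
  obtains f A where "ob_rep X A" "\<Theta> \<rhd> [A] \<turnstile> f \<Colon> B" "rep F A (inst f (Var 0)) B"
proof -
  obtain A where "ob_rep X A"
    using assms(1) by (auto simp: hom_def arr_iff dest: ob_src)
  with assms show ?thesis
    using hom_rep that by blast
qed

lemma hom_reps:
  assumes "F \<in> hom SC X Y"
  obtains f A B where "ob_rep X A" "ob_rep Y B" "\<Theta> \<rhd> [A] \<turnstile> f \<Colon> B" "rep F A (inst f (Var 0)) B"
proof -
  obtain A where "ob_rep X A"
    using assms(1) by (auto simp: hom_def arr_iff dest: ob_src)
  with assms show ?thesis
    using hom_rep_trg that by blast
qed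

lemma tm_cls_conv:
  "\<Theta> \<rhd> [A] \<turnstile> f \<Colon> B \<Longrightarrow> \<Theta> \<rhd>\<^sub>t A \<approx> A' \<Longrightarrow> \<Theta> \<rhd>\<^sub>t B \<approx> B' \<Longrightarrow> tm_cls \<Theta> A' f B' = tm_cls \<Theta> A f B"
  by (rule tm_cls_cong[symmetric]) (auto intro: e_refl)

text \<open>One scheme serves all structure maps indexed by an object: \<open>t\<close> carries no
  type annotation, so another representative \<open>A'\<close> changes only the types
  \<open>P A\<close> and \<open>Q A\<close>.\<close>

lemma rep_UN:
  assumes "ob_rep Y A" "\<Theta> \<rhd> [P A] \<turnstile> t \<Colon> Q A"
    and "\<And>A'. \<Theta> \<rhd>\<^sub>t A \<approx> A' \<Longrightarrow> \<Theta> \<rhd>\<^sub>t P A \<approx> P A'" "\<And>A'. \<Theta> \<rhd>\<^sub>t A \<approx> A' \<Longrightarrow> \<Theta> \<rhd>\<^sub>t Q A \<approx> Q A'"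
  shows "rep (\<Union>A \<in> Y. tm_cls \<Theta> (P A) t (Q A)) (P A) t (Q A)"
proof -
  have "(\<Union>A' \<in> ty_cls \<Theta> A. tm_cls \<Theta> (P A') t (Q A')) = tm_cls \<Theta> (P A) t (Q A)"
    using assms by (intro UN_ty_cls tm_cls_conv) (auto simp: ob_rep_def)
  then show ?thesis
    using assms(1,2) by (simp add: rep_def ob_rep_def)
qed

lemma rep_UN2:
  assumes "ob_rep Y A" "ob_rep Z B" "\<Theta> \<rhd> [P A B] \<turnstile> t \<Colon> Q A B"
    and "\<And>A' B'. \<Theta> \<rhd>\<^sub>t A \<approx> A' \<Longrightarrow> \<Theta> \<rhd>\<^sub>t B \<approx> B' \<Longrightarrow> \<Theta> \<rhd>\<^sub>t P A B \<approx> P A' B'"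
    and "\<And>A' B'. \<Theta> \<rhd>\<^sub>t A \<approx> A' \<Longrightarrow> \<Theta> \<rhd>\<^sub>t B \<approx> B' \<Longrightarrow> \<Theta> \<rhd>\<^sub>t Q A B \<approx> Q A' B'"
  shows "rep (\<Union>A \<in> Y. \<Union>B \<in> Z. tm_cls \<Theta> (P A B) t (Q A B)) (P A B) t (Q A B)"
proof -
  have "(\<Union>A' \<in> ty_cls \<Theta> A. \<Union>B' \<in> ty_cls \<Theta> B. tm_cls \<Theta> (P A' B') t (Q A' B')) = tm_cls \<Theta> (P A B) t (Q A B)"
    using assms by (intro UN_ty_cls2 tm_cls_conv) (auto simp: ob_rep_def)
  then show ?thesis
    using assms(1-3) by (simp add: rep_def ob_rep_def)
qed

lemma rep_ide: "ob_rep X A \<Longrightarrow> rep (ide SC X) A (Var 0) A"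
  unfolding syn_cat_def cat.simps
  by (rule rep_UN[where P = "\<lambda>A. A" and Q = "\<lambda>A. A"]) (auto simp: ob_rep_def intro: t_var0)

text \<open>The middle types stored in the two classes are ignored, so only the dependence on
  \<open>f\<close> and \<open>g\<close> matters. The inner union is collapsed for every
  representative \<open>f'\<close> first, because collapsing the outer one compares two such
  unions.\<close>

lemma rep_cmp:
  assumes "rep F A f B" "rep G B g D"
  shows "rep (cmp SC G F) A (inst g f) D"
proof -
  have f: "\<Theta> \<rhd> [A] \<turnstile> f \<Colon> B" and F: "F = tm_cls \<Theta> A f B"
    and g: "\<Theta> \<rhd> [B] \<turnstile> g \<Colon> D" and G: "G = tm_cls \<Theta> B g D"
    using assms by (auto simp: rep_def)
  have A: "\<Theta> \<rhd>\<^sub>t A \<approx> A"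
    using rep_wf[OF assms(1)] ty_refl by blast
  have inner: "(\<Union>(B'', g, D) \<in> tm_cls \<Theta> B g D. tm_cls \<Theta> A' (inst g f') D) = tm_cls \<Theta> A' (inst g f') D"
    if "\<Theta> \<rhd>\<^sub>t A \<approx> A'" "\<Theta> \<rhd> [A] \<turnstile> f \<approx> f' \<Colon> B" for A' f'
  proof (rule UN_tm_cls[OF g])
    fix D' g' assume "\<Theta> \<rhd>\<^sub>t D \<approx> D'" "\<Theta> \<rhd> [B] \<turnstile> g \<approx> g' \<Colon> D"
    moreover have "\<Theta> \<rhd> [A'] \<turnstile> f' \<approx> f' \<Colon> B"
      using that tm_eq_has_ty has_ty_conv_hd e_refl by blast
    moreover have "\<Theta> \<rhd>\<^sub>t A' \<approx> A'"
      using that ty_eq_wf ty_refl by blast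
    ultimately show "tm_cls \<Theta> A' (inst g' f') D' = tm_cls \<Theta> A' (inst g f') D"
      by (intro tm_cls_cong[symmetric] inst_single_cong)
  qed
  have "cmp SC G F = (\<Union>(A, f, B') \<in> tm_cls \<Theta> A f B.
      \<Union>(B'', g, D) \<in> tm_cls \<Theta> B g D. tm_cls \<Theta> A (inst g f) D)"
    by (simp add: syn_cat_def F G)
  also have "\<dots> = (\<Union>(B'', g, D) \<in> tm_cls \<Theta> B g D. tm_cls \<Theta> A (inst g f) D)"
  proof (rule UN_tm_cls[OF f])
    fix A' f' assume *: "\<Theta> \<rhd>\<^sub>t A \<approx> A'" "\<Theta> \<rhd> [A] \<turnstile> f \<approx> f' \<Colon> B"
    have "tm_cls \<Theta> A (inst g f) D = tm_cls \<Theta> A' (inst g f') D"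
      using * rep_wf[OF assms(2)] by (intro tm_cls_cong ev_inst[OF g]) (auto intro: ty_refl)
    then show "(\<Union>(B'', g, D) \<in> tm_cls \<Theta> B g D. tm_cls \<Theta> A' (inst g f') D)
        = (\<Union>(B'', g, D) \<in> tm_cls \<Theta> B g D. tm_cls \<Theta> A (inst g f) D)"
      using inner[OF *] inner[OF A e_refl[OF f]] by simp
  qed
  also have "\<dots> = tm_cls \<Theta> A (inst g f) D"
    by (rule inner[OF A e_refl[OF f]])
  finally have "cmp SC G F = tm_cls \<Theta> A (inst g f) D" .
  then show ?thesis
    using f g by (simp add: rep_def t_inst)
qed


section \<open>Representatives of the structure maps\<close>

lemma ob_one: "ob_rep (one SC) Unit"
  by (simp add: ob_rep_def syn_cat_def)

lemma ob_prd:
  assumes "ob_rep X A" "ob_rep Y B"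
  shows "ob_rep (prd SC X Y) (Prod A B)"
  using assms UN_ty_cls2[of A B "\<lambda>A B. ty_cls \<Theta> (Prod A B)", OF _ _ ty_cls_eq[OF ty_prod]]
  by (simp add: ob_rep_def syn_cat_def)

lemma ob_expo:
  assumes "ob_rep X A" "ob_rep Y B"
  shows "ob_rep (expo SC X Y) (Fun A B)"
  using assms UN_ty_cls2[of A B "\<lambda>A B. ty_cls \<Theta> (Fun A B)", OF _ _ ty_cls_eq[OF ty_fun]]
  by (simp add: ob_rep_def syn_cat_def)

lemma ob_fob:
  assumes "ob_rep Y A"
  shows "ob_rep (fob (SM X) Y) (Mon X A)"
  using assms UN_ty_cls[of A "\<lambda>A. ty_cls \<Theta> (Mon X A)", OF _ ty_cls_eq[OF ty_mon]]
  by (simp add: ob_rep_def syn_monad_def)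

lemma ob_wf: "ob_rep Y A \<Longrightarrow> wf_ty \<Theta> A"
  by (simp add: ob_rep_def)

lemma rep_proj1:
  assumes "ob_rep X A" "ob_rep Y B"
  shows "rep (proj1 SC X Y) (Prod A B) (Pr1 (Var 0)) A"
proof -
  have "\<Theta> \<rhd> [Prod A B] \<turnstile> Pr1 (Var 0) \<Colon> A"
    by (rule ty_intros ob_wf assms)+
  then show ?thesis
    unfolding syn_cat_def ccc.simps
    using assms by (intro rep_UN2[where Q = "\<lambda>A B. A"]) (auto intro: ty_prod)
qed

lemma rep_proj2:
  assumes "ob_rep X A" "ob_rep Y B"
  shows "rep (proj2 SC X Y) (Prod A B) (Pr2 (Var 0)) B"
proof -
  have "\<Theta> \<rhd> [Prod A B] \<turnstile> Pr2 (Var 0) \<Colon> B"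
    by (rule ty_intros ob_wf assms)+
  then show ?thesis
    unfolding syn_cat_def ccc.simps
    using assms by (intro rep_UN2[where Q = "\<lambda>A B. B"]) (auto intro: ty_prod)
qed

lemma rep_ev:
  assumes "ob_rep X A" "ob_rep Y B"
  shows "rep (ev SC X Y) (Prod (Fun A B) A) (App (Pr1 (Var 0)) (Pr2 (Var 0))) B"
proof -
  have "\<Theta> \<rhd> [Prod (Fun A B) A] \<turnstile> App (Pr1 (Var 0)) (Pr2 (Var 0)) \<Colon> B"
    by (rule ty_intros ob_wf assms)+
  then show ?thesis
    unfolding syn_cat_def ccc.simps
    using assms by (intro rep_UN2[where Q = "\<lambda>A B. B"]) (auto intro: ty_prod ty_fun)
qed

lemma rep_unit:
  assumes "ob_rep Y A"
  shows "rep (unit (SM X) Y) A (Ret X (Var 0)) (Mon X A)"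
proof -
  have "\<Theta> \<rhd> [A] \<turnstile> Ret X (Var 0) \<Colon> Mon X A"
    by (rule ty_intros ob_wf assms)+
  then show ?thesis
    unfolding syn_monad_def monad.simps
    using assms by (intro rep_UN[where P = "\<lambda>A. A"]) (auto intro: ty_mon)
qed

lemma rep_mult:
  assumes "ob_rep Y A"
  shows "rep (mult (SM X) Y) (Mon X (Mon X A)) (Do X (Var 0) (Var 0)) (Mon X A)"
proof -
  have "\<Theta> \<rhd> [Mon X (Mon X A)] \<turnstile> Do X (Var 0) (Var 0) \<Colon> Mon X A"
    by (rule ty_intros ob_wf assms)+
  then show ?thesis
    unfolding syn_monad_def monad.simps
    using assms by (intro rep_UN[where P = "\<lambda>A. Mon X (Mon X A)"]) (auto intro: ty_mon)
qed

lemma rep_str: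
  assumes "ob_rep Y A" "ob_rep Z B"
  shows "rep (str (SM X) Y Z) (Prod A (Mon X B))
    (Do X (Pr2 (Var 0)) (Ret X (Pair (Pr1 (Var (Suc 0))) (Var 0)))) (Mon X (Prod A B))"
proof -
  have "\<Theta> \<rhd> [Prod A (Mon X B)]
    \<turnstile> Do X (Pr2 (Var 0)) (Ret X (Pair (Pr1 (Var (Suc 0))) (Var 0))) \<Colon> Mon X (Prod A B)"
    by (rule ty_intros ob_wf assms)+
  then show ?thesis
    \<comment> \<open>Index 1 in the definition is rewritten to \<open>Suc 0\<close>, the form that
      \<open>t_varS\<close> recognises.\<close>
    unfolding syn_monad_def monad.simps One_nat_def
    using assms by (intro rep_UN2[where P = "\<lambda>A B. Prod A (Mon X B)"]) (auto intro: ty_mon ty_prod)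
qed

lemma rep_iota:
  assumes "ob_rep Y A"
  shows "rep (syn_iota \<Theta> Y) (Mon MS A) (Iota (Var 0)) (Mon MT A)"
proof -
  have "\<Theta> \<rhd> [Mon MS A] \<turnstile> Iota (Var 0) \<Colon> Mon MT A"
    by (rule ty_intros ob_wf assms)+
  then show ?thesis
    unfolding syn_iota_def
    using assms by (intro rep_UN[where P = "\<lambda>A. Mon MS A"]) (auto intro: ty_mon)
qed

lemma rep_far:
  assumes "rep F A f B"
  shows "rep (far (SM X) F) (Mon X A) (Do X (Var 0) (Ret X f)) (Mon X B)"
proof -
  have f: "\<Theta> \<rhd> [A] \<turnstile> f \<Colon> B" and F: "F = tm_cls \<Theta> A f B"
    using assms by (auto simp: rep_def)
  have wf: "wf_ctx \<Theta> [Mon X A]"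
    using rep_wf[OF assms] by simp
  \<comment> \<open>The body of the \<open>Do\<close> lives over \<open>[A, Mon X A]\<close>, so an
    equation over \<open>[A]\<close> is weakened by an older variable; \<open>f\<close> itself needs
    no renaming.\<close>
  have *: "\<Theta> \<rhd> [Mon X A] \<turnstile> Do X (Var 0) (Ret X f) \<approx> Do X (Var 0) (Ret X f') \<Colon> Mon X B"
    if "\<Theta> \<rhd> [A] \<turnstile> f \<approx> f' \<Colon> B" for f'
    by (rule e_do[OF e_refl[OF t_var0[OF wf]] e_ret[OF tm_eq_weak_single[OF that wf]]])
  have "far (SM X) F = (\<Union>(A, f, B) \<in> tm_cls \<Theta> A f B.
      tm_cls \<Theta> (Mon X A) (Do X (Var 0) (Ret X f)) (Mon X B))"
    by (simp add: syn_monad_def F)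
  also have "\<dots> = tm_cls \<Theta> (Mon X A) (Do X (Var 0) (Ret X f)) (Mon X B)"
    using * by (intro UN_tm_cls[OF f] tm_cls_cong[symmetric]) (auto intro: ty_mon)
  finally show ?thesis
    using *[OF e_refl[OF f]] tm_eq_has_ty by (auto simp: rep_def)
qed

section \<open>Universal arrows characterised by their representatives\<close>

lemma terminal_iff:
  assumes "ob_rep X A"
  shows "F \<in> hom SC X (one SC) \<longleftrightarrow> rep F A Star Unit"
proof
  assume "F \<in> hom SC X (one SC)"
  then obtain f where "\<Theta> \<rhd> [A] \<turnstile> f \<Colon> Unit" and r: "rep F A (inst f (Var 0)) Unit"
    using hom_rep[OF _ assms ob_one] by blast
  then have "rep F A f Unit"
    by (simp add: inst_self)
  then show "rep F A Star Unit"
    by (rule rep_cong) (rule e_unit_eta, fact)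
next
  assume "rep F A Star Unit"
  then show "F \<in> hom SC X (one SC)"
    using assms ob_one by (rule rep_hom)
qed

text \<open>A representative determines its arrow. Once a universal property is rewritten as a
  statement \<open>rep F A f B\<close>, a typing of \<open>f\<close> yields unique existence and,
  through \<open>rep_The\<close>, the value of the definite description in \<open>bang\<close>,
  \<open>tuple\<close> and \<open>curry_arr\<close>.\<close>

lemma rep_Ex1: "\<Theta> \<rhd> [A] \<turnstile> f \<Colon> B \<Longrightarrow> \<exists>!F. rep F A f B"
  by (auto simp: rep_def)

lemma rep_The: "\<Theta> \<rhd> [A] \<turnstile> f \<Colon> B \<Longrightarrow> rep (THE F. rep F A f B) A f B"
  by (rule theI') (rule rep_Ex1)

lemma rep_bang:
  assumes "ob_rep X A"
  shows "rep (bang SC X) A Star Unit"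
proof -
  have "\<Theta> \<rhd> [A] \<turnstile> Star \<Colon> Unit"
    by (rule ty_intros ob_wf assms)+
  then show ?thesis
    unfolding bang_def terminal_iff[OF assms] by (rule rep_The)
qed

text \<open>Uniqueness is surjective pairing, existence the two projection laws.\<close>

lemma product_iff:
  assumes F: "rep F A f B" and G: "rep G A g D"
    and obs: "ob_rep Z A" "ob_rep X B" "ob_rep Y D"
  shows "H \<in> hom SC Z (prd SC X Y) \<and> cmp SC (proj1 SC X Y) H = F \<and> cmp SC (proj2 SC X Y) H = G
    \<longleftrightarrow> rep H A (Pair f g) (Prod B D)"
proof
  assume H: "H \<in> hom SC Z (prd SC X Y) \<and> cmp SC (proj1 SC X Y) H = F \<and> cmp SC (proj2 SC X Y) H = G"
  then obtain h where h: "\<Theta> \<rhd> [A] \<turnstile> h \<Colon> Prod B D" and r: "rep H A h (Prod B D)"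
    using hom_rep[OF _ obs(1) ob_prd[OF obs(2,3)]] inst_self by metis
  have "\<Theta> \<rhd> [A] \<turnstile> Pr1 h \<approx> f \<Colon> B" "\<Theta> \<rhd> [A] \<turnstile> Pr2 h \<approx> g \<Colon> D"
    using rep_eqD[OF _ F] rep_eqD[OF _ G] rep_cmp[OF r rep_proj1[OF obs(2,3)]]
      rep_cmp[OF r rep_proj2[OF obs(2,3)]] H by simp_all
  then have "\<Theta> \<rhd> [A] \<turnstile> h \<approx> Pair f g \<Colon> Prod B D"
    using e_prod_eta[OF h] by (blast intro: e_pair e_trans e_sym)
  with r show "rep H A (Pair f g) (Prod B D)"
    by (rule rep_cong)
next
  assume H: "rep H A (Pair f g) (Prod B D)"
  have fg: "\<Theta> \<rhd> [A] \<turnstile> f \<Colon> B" "\<Theta> \<rhd> [A] \<turnstile> g \<Colon> D"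
    using F G by (simp_all add: rep_def)
  have "cmp SC (proj1 SC X Y) H = F"
    by (rule rep_eqI[OF rep_cmp[OF H rep_proj1[OF obs(2,3)]] F]) (simp add: e_pr1_beta[OF fg])
  moreover have "cmp SC (proj2 SC X Y) H = G"
    by (rule rep_eqI[OF rep_cmp[OF H rep_proj2[OF obs(2,3)]] G]) (simp add: e_pr2_beta[OF fg])
  ultimately show "H \<in> hom SC Z (prd SC X Y) \<and> cmp SC (proj1 SC X Y) H = F \<and> cmp SC (proj2 SC X Y) H = G"
    using rep_hom[OF H obs(1) ob_prd[OF obs(2,3)]] by simp
qed

lemma rep_tuple:
  assumes "rep F A f B" "rep G A g D"
  shows "rep (tuple SC F G) A (Pair f g) (Prod B D)"
proof -
  have "\<Theta> \<rhd> [A] \<turnstile> Pair f g \<Colon> Prod B D"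
    using assms by (auto simp: rep_def intro: t_pair)
  then show ?thesis
    unfolding tuple_def
      product_iff[OF assms ob_src[OF assms(1)] ob_trg[OF assms(1)] ob_trg[OF assms(2)]]
    by (rule rep_The)
qed

lemma rep_prod_arr:
  assumes "rep F A f B" "rep G A' g B'"
  shows "rep (prod_arr SC F G) (Prod A A') (Pair (inst f (Pr1 (Var 0))) (inst g (Pr2 (Var 0)))) (Prod B B')"
  unfolding prod_arr_def by (rule rep_tuple rep_cmp rep_proj1 rep_proj2 ob_src assms)+

lemma rep_swap:
  "ob_rep X A \<Longrightarrow> ob_rep Y B
    \<Longrightarrow> rep (swap SC X Y) (Prod A B) (Pair (Pr2 (Var 0)) (Pr1 (Var 0))) (Prod B A)"
  unfolding swap_def by (intro rep_tuple rep_proj1 rep_proj2)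

lemma rep_assoc:
  assumes "ob_rep X A" "ob_rep Y B" "ob_rep Z D"
  shows "rep (assoc SC X Y Z) (Prod (Prod A B) D)
    (Pair (Pr1 (Pr1 (Var 0))) (Pair (Pr2 (Pr1 (Var 0))) (Pr2 (Var 0)))) (Prod A (Prod B D))"
proof -
  have "rep (assoc SC X Y Z) (Prod (Prod A B) D)
    (Pair (inst (Pr1 (Var 0)) (Pr1 (Var 0))) (Pair (inst (Pr2 (Var 0)) (Pr1 (Var 0))) (Pr2 (Var 0))))
    (Prod A (Prod B D))"
    unfolding assoc_def
    by (rule rep_tuple rep_cmp rep_proj1 rep_proj2 ob_prd assms)+
  then show ?thesis
    by simp
qed


section \<open>The syntactic category is cartesian closed\<close>

lemma ev_app:
  assumes "\<Theta> \<rhd> \<Gamma> \<turnstile> M \<approx> Lam A P \<Colon> Fun A B" "\<Theta> \<rhd> \<Gamma> \<turnstile> N \<approx> N' \<Colon> A"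
    and "\<Theta> \<rhd> A # \<Gamma> \<turnstile> P \<Colon> B" "\<Theta> \<rhd> \<Gamma> \<turnstile> N' \<Colon> A" "inst P N' = Q" "\<Theta> \<rhd> \<Gamma> \<turnstile> Q \<approx> R \<Colon> B"
  shows "\<Theta> \<rhd> \<Gamma> \<turnstile> App M N \<approx> R \<Colon> B"
  using e_trans[OF e_app[OF assms(1,2)] e_trans[OF e_fun_beta[OF assms(3,4)]]] assms(5,6) by blast

text \<open>Substituting the pair of two variables turns a term over \<open>Prod A B\<close> into
  one over two variables, which can be abstracted. Function eta then gives uniqueness; function beta
  with product eta gives existence.\<close>

lemma exponential_iff:
  assumes F: "rep F (Prod A B) (inst f (Var 0)) D" and f: "\<Theta> \<rhd> [Prod A B] \<turnstile> f \<Colon> D"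
    and obs: "ob_rep Z A" "ob_rep X B" "ob_rep Y D"
  shows "G \<in> hom SC Z (expo SC X Y) \<and> cmp SC (ev SC X Y) (prod_arr SC G (ide SC X)) = F
    \<longleftrightarrow> rep G A (Lam B (inst f (Pair (Var (Suc 0)) (Var 0)))) (Fun B D)"
proof
  let ?p = "Pair (Var (Suc 0)) (Var 0)"
  assume G: "G \<in> hom SC Z (expo SC X Y) \<and> cmp SC (ev SC X Y) (prod_arr SC G (ide SC X)) = F"
  then obtain g where g: "\<Theta> \<rhd> [A] \<turnstile> g \<Colon> Fun B D" and r: "rep G A (inst g (Var 0)) (Fun B D)"
    using hom_rep[OF _ obs(1) ob_expo[OF obs(2,3)]] by metis
  have p: "\<Theta> \<rhd> [B, A] \<turnstile> ?p \<Colon> Prod A B"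
    by (rule ty_intros ob_wf obs)+
  have "\<Theta> \<rhd> [Prod A B] \<turnstile> inst (App (Pr1 (Var 0)) (Pr2 (Var 0)))
      (Pair (inst (inst g (Var 0)) (Pr1 (Var 0))) (inst (Var 0) (Pr2 (Var 0)))) \<approx> inst f (Var 0) \<Colon> D"
    using rep_eqD[OF _ F] rep_cmp[OF rep_prod_arr[OF r rep_ide[OF obs(2)]] rep_ev[OF obs(2,3)]] G
    by metis
  \<comment> \<open>The packed variable is replaced by \<open>?p\<close>, which moves the equation
    to \<open>[B, A]\<close>, where the newest variable can be bound.\<close>
  from inst_single_cong[OF this e_refl[OF p]]
  have "\<Theta> \<rhd> [B, A] \<turnstile> App (Pr1 (Pair (inst g (Pr1 ?p)) (Pr2 ?p))) (Pr2 (Pair (inst g (Pr1 ?p)) (Pr2 ?p)))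
      \<approx> inst f ?p \<Colon> D"
    by (simp add: single[OF g] single[OF f])
  moreover have "\<Theta> \<rhd> [B, A] \<turnstile> App (Pr1 (Pair (inst g (Pr1 ?p)) (Pr2 ?p))) (Pr2 (Pair (inst g (Pr1 ?p)) (Pr2 ?p)))
      \<approx> App (inst g (Var (Suc 0))) (Var 0) \<Colon> D"
    by (rule e_app ev_rules g ty_intros ob_wf obs)+
  ultimately have "\<Theta> \<rhd> [A] \<turnstile> Lam B (App (lift (inst g (Var 0))) (Var 0)) \<approx> Lam B (inst f ?p) \<Colon> Fun B D"
    unfolding single[OF g] ren.simps
    by (intro e_lam ty_refl ob_wf[OF obs(2)]) (blast intro: e_trans e_sym)
  moreover have "\<Theta> \<rhd> [A] \<turnstile> Lam B (App (lift (inst g (Var 0))) (Var 0)) \<approx> inst g (Var 0) \<Colon> Fun B D"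
    by (rule e_fun_eta g ty_intros ob_wf obs)+
  ultimately show "rep G A (Lam B (inst f ?p)) (Fun B D)"
    using r by (blast intro: rep_cong e_sym e_trans)
next
  let ?p = "Pair (Var (Suc 0)) (Var 0)"
  assume G: "rep G A (Lam B (inst f ?p)) (Fun B D)"
  have "cmp SC (ev SC X Y) (prod_arr SC G (ide SC X)) = F"
  proof (rule rep_eqI[OF rep_cmp[OF rep_prod_arr[OF G rep_ide[OF obs(2)]] rep_ev[OF obs(2,3)]] F])
    have v: "\<Theta> \<rhd> [Prod A B] \<turnstile> Var 0 \<Colon> Prod A B"
      by (rule ty_intros ob_wf obs)+
    \<comment> \<open>The abstraction representing \<open>G\<close>, with its free variable replaced
      by the first projection, as it occurs in the product of \<open>G\<close> with the
      identity.\<close>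
    let ?G = "Lam B (inst f (Pair (Pr1 (Var (Suc 0))) (Var 0)))"
    have "\<Theta> \<rhd> [Prod A B] \<turnstile> App (Pr1 (Pair ?G (Pr2 (Var 0)))) (Pr2 (Pair ?G (Pr2 (Var 0)))) \<approx> inst f (Var 0) \<Colon> D"
    proof (rule ev_app)
      show "inst (inst f (Pair (Pr1 (Var (Suc 0))) (Var 0))) (Pr2 (Var 0)) = inst f (Pair (Pr1 (Var 0)) (Pr2 (Var 0)))"
        by (simp add: single[OF f])
      show "\<Theta> \<rhd> [Prod A B] \<turnstile> inst f (Pair (Pr1 (Var 0)) (Pr2 (Var 0))) \<approx> inst f (Var 0) \<Colon> D"
        by (rule ev_inst[OF f e_prod_eta[OF v]])
    qed (rule ev_pr1 ev_pr2 e_refl ty_intros f ob_wf obs)+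
    then show "\<Theta> \<rhd> [Prod A B] \<turnstile> inst (App (Pr1 (Var 0)) (Pr2 (Var 0)))
        (Pair (inst (Lam B (inst f ?p)) (Pr1 (Var 0))) (inst (Var 0) (Pr2 (Var 0)))) \<approx> inst f (Var 0) \<Colon> D"
      by (simp add: single[OF f])
  qed
  then show "G \<in> hom SC Z (expo SC X Y) \<and> cmp SC (ev SC X Y) (prod_arr SC G (ide SC X)) = F"
    using rep_hom[OF G obs(1) ob_expo[OF obs(2,3)]] by simp
qed

lemma rep_curry:
  assumes F: "rep F (Prod A B) f D" and obs: "ob_rep Z A" "ob_rep X B"
  shows "rep (curry_arr SC Z X F) A (Lam B (inst f (Pair (Var (Suc 0)) (Var 0)))) (Fun B D)"
proof -
  have f: "\<Theta> \<rhd> [Prod A B] \<turnstile> f \<Colon> D"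
    using F by (simp add: rep_def)
  have "\<Theta> \<rhd> [A] \<turnstile> Lam B (inst f (Pair (Var (Suc 0)) (Var 0))) \<Colon> Fun B D"
    by (rule ty_intros f ob_wf obs)+
  moreover have "rep F (Prod A B) (inst f (Var 0)) D"
    using F by (simp add: inst_self[OF f])
  ultimately show ?thesis
    using exponential_iff[OF _ f obs ob_trg[OF F]] rep_The by (simp add: curry_arr_def)
qed

lemma category_syn: "category SC"
proof
  fix F assume "F \<in> arr SC"
  then show "src SC F \<in> obj SC" "trg SC F \<in> obj SC"
    by (auto simp: arr_iff intro: obj_rep ob_src ob_trg)
next
  fix X assume "X \<in> obj SC"
  then show "ide SC X \<in> hom SC X X"
    by (auto simp: obj_iff intro: rep_hom rep_ide)
next
  fix F G X Y Z assume "F \<in> hom SC X Y" "G \<in> hom SC Y Z"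
  then show "cmp SC G F \<in> hom SC X Z"
    by (metis hom_reps hom_rep_trg rep_cmp rep_hom)
next
  fix F X Y assume "F \<in> hom SC X Y"
  then obtain A B f where f: "ob_rep X A" "ob_rep Y B" "\<Theta> \<rhd> [A] \<turnstile> f \<Colon> B" "rep F A (inst f (Var 0)) B"
    by (rule hom_reps)
  then show "cmp SC F (ide SC X) = F"
    using rep_unique[OF rep_cmp[OF rep_ide[OF f(1)] f(4)], of F] by (simp add: single[OF f(3)])
  from f show "cmp SC (ide SC Y) F = F"
    using rep_unique[OF rep_cmp[OF f(4) rep_ide[OF f(2)]], of F] by simp
next
  fix F G H W X Y Z assume hom: "F \<in> hom SC W X" "G \<in> hom SC X Y" "H \<in> hom SC Y Z"
  from hom(1) obtain A B f where f: "ob_rep X B" "rep F A (inst f (Var 0)) B"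
    by (rule hom_reps)
  from hom(2) f(1) obtain D g where g: "ob_rep Y D" "\<Theta> \<rhd> [B] \<turnstile> g \<Colon> D" "rep G B (inst g (Var 0)) D"
    by (rule hom_rep_trg)
  from hom(3) g(1) obtain E h where h: "\<Theta> \<rhd> [D] \<turnstile> h \<Colon> E" "rep H D (inst h (Var 0)) E"
    by (rule hom_rep_trg)
  have "rep (cmp SC (cmp SC H G) F) A (inst (inst (inst h (Var 0)) (inst g (Var 0))) (inst f (Var 0))) E"
    "rep (cmp SC H (cmp SC G F)) A (inst (inst h (Var 0)) (inst (inst g (Var 0)) (inst f (Var 0)))) E"
    by (rule rep_cmp f(2) g(3) h(2))+
  then show "cmp SC (cmp SC H G) F = cmp SC H (cmp SC G F)"
    using rep_unique by (simp add: single[OF g(2)] single[OF h(1)])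
qed

lemma cartesian_closed_syn: "cartesian_closed SC"
proof -
  interpret category SC by (rule category_syn)
  show ?thesis
  proof
    show "one SC \<in> obj SC"
      by (rule obj_rep[OF ob_one])
  next
    fix X assume "X \<in> obj SC"
    then obtain A where obs: "ob_rep X A"
      by (auto simp: obj_iff)
    have "\<Theta> \<rhd> [A] \<turnstile> Star \<Colon> Unit"
      by (rule ty_intros ob_wf obs)+
    then show "\<exists>!F. F \<in> hom SC X (one SC)"
      unfolding terminal_iff[OF obs] by (rule rep_Ex1)
  next
    fix X Y assume "X \<in> obj SC" "Y \<in> obj SC"
    then obtain A B where "ob_rep X A" "ob_rep Y B"
      by (auto simp: obj_iff)
    note obs = this ob_prd[OF this] ob_expo[OF this]
    show "prd SC X Y \<in> obj SC" "expo SC X Y \<in> obj SC"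
      by (rule obj_rep, rule obs)+
    show "proj1 SC X Y \<in> hom SC (prd SC X Y) X" "proj2 SC X Y \<in> hom SC (prd SC X Y) Y"
      using rep_proj1[OF obs(1,2)] rep_proj2[OF obs(1,2)] obs rep_hom by blast+
    show "ev SC X Y \<in> hom SC (prd SC (expo SC X Y) X) Y"
      using rep_ev[OF obs(1,2)] obs ob_prd rep_hom by blast
  next
    fix F G X Y Z assume hom: "F \<in> hom SC Z X" "G \<in> hom SC Z Y"
    from hom(1) obtain A B f where f: "ob_rep Z A" "ob_rep X B" "rep F A (inst f (Var 0)) B"
      by (rule hom_reps)
    from hom(2) f(1) obtain D g where g: "ob_rep Y D" "rep G A (inst g (Var 0)) D"
      by (rule hom_rep_trg)
    have "\<Theta> \<rhd> [A] \<turnstile> Pair (inst f (Var 0)) (inst g (Var 0)) \<Colon> Prod B D"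
      using f(3) g(2) by (auto simp: rep_def intro: t_pair)
    then show "\<exists>!H. H \<in> hom SC Z (prd SC X Y) \<and> cmp SC (proj1 SC X Y) H = F \<and> cmp SC (proj2 SC X Y) H = G"
      unfolding product_iff[OF f(3) g(2) f(1,2) g(1)] by (rule rep_Ex1)
  next
    fix F X Y Z assume "Z \<in> obj SC" "X \<in> obj SC" and hom: "F \<in> hom SC (prd SC Z X) Y"
    then obtain A B where obs: "ob_rep Z A" "ob_rep X B"
      by (auto simp: obj_iff)
    from hom ob_prd[OF this] obtain D f where D: "ob_rep Y D" and f: "\<Theta> \<rhd> [Prod A B] \<turnstile> f \<Colon> D"
      and F: "rep F (Prod A B) (inst f (Var 0)) D"
      by (rule hom_rep_trg)
    have "\<Theta> \<rhd> [A] \<turnstile> Lam B (inst f (Pair (Var (Suc 0)) (Var 0))) \<Colon> Fun B D"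
      by (rule ty_intros f ob_wf obs)+
    then show "\<exists>!G. G \<in> hom SC Z (expo SC X Y) \<and> cmp SC (ev SC X Y) (prod_arr SC G (ide SC X)) = F"
      unfolding exponential_iff[OF F f obs D] by (rule rep_Ex1)
  qed
qed


section \<open>The syntactic strong monads\<close>

text \<open>These rules follow the shape of a categorical expression, so resolution with schematic
  terms and types computes a representative of any composite.\<close>

lemmas rep_rules = rep_far rep_unit rep_mult rep_str rep_iota rep_prod_arr rep_tuple rep_swap
  rep_assoc rep_proj1 rep_proj2 rep_ev rep_bang rep_ide rep_cmp
  ob_fob ob_prd ob_expo ob_one

lemma strong_monad_syn: "strong_monad SC (SM X)"
proof -
  interpret cartesian_closed SC by (rule cartesian_closed_syn)
  show ?thesis
  proof
    fix Y assume "Y \<in> obj SC"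
    then obtain A where Y: "ob_rep Y A"
      by (auto simp: obj_iff)
    note rules = rep_rules Y
    note tys = ev_rules ty_intros ob_wf[OF Y]
    show "fob (SM X) Y \<in> obj SC"
      by (rule obj_rep rules)+
    show "unit (SM X) Y \<in> hom SC Y (fob (SM X) Y)"
      by (rule rep_hom rules)+
    show "mult (SM X) Y \<in> hom SC (fob (SM X) (fob (SM X) Y)) (fob (SM X) Y)"
      by (rule rep_hom rules)+
    show "far (SM X) (ide SC Y) = ide SC (fob (SM X) Y)"
      by (rule rep_eqI, (rule rules)+, rule ev_join, (rule tys)+)
    show "cmp SC (mult (SM X) Y) (unit (SM X) (fob (SM X) Y)) = ide SC (fob (SM X) Y)"
      by (rule rep_eqI, (rule rules)+, simp, rule ev_join, (rule tys | simp)+)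
    show "cmp SC (mult (SM X) Y) (far (SM X) (unit (SM X) Y)) = ide SC (fob (SM X) Y)"
      by (rule rep_eqI, (rule rules)+, simp, rule ev_join, (rule tys | simp)+)
    show "cmp SC (mult (SM X) Y) (mult (SM X) (fob (SM X) Y))
      = cmp SC (mult (SM X) Y) (far (SM X) (mult (SM X) Y))"
      by (rule rep_eqI, (rule rules)+, simp, rule ev_join, (rule tys | simp)+)
    show "cmp SC (far (SM X) (proj2 SC (one SC) Y)) (str (SM X) (one SC) Y) = proj2 SC (one SC) (fob (SM X) Y)"
      by (rule rep_eqI, (rule rules)+, simp, rule ev_join, (rule tys | simp)+)
  next
    fix F Y Z assume hom: "F \<in> hom SC Y Z"
    from hom obtain A B f where Y: "ob_rep Y A" and Z: "ob_rep Z B"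
      and f: "\<Theta> \<rhd> [A] \<turnstile> f \<Colon> B" and F: "rep F A (inst f (Var 0)) B"
      by (rule hom_reps)
    note rules = F rep_rules Y Z
    note tys = f ev_rules ty_intros ob_wf[OF Y] ob_wf[OF Z]
    show "far (SM X) F \<in> hom SC (fob (SM X) Y) (fob (SM X) Z)"
      by (rule rep_hom rules)+
    show "cmp SC (far (SM X) F) (unit (SM X) Y) = cmp SC (unit (SM X) Z) F"
      by (rule rep_eqI, (rule rules)+, simp add: single[OF f],
          rule ev_join, (rule tys | simp add: single[OF f])+)
    show "cmp SC (far (SM X) F) (mult (SM X) Y) = cmp SC (mult (SM X) Z) (far (SM X) (far (SM X) F))"
      by (rule rep_eqI, (rule rules)+, simp add: single[OF f],
          rule ev_join, (rule tys | simp add: single[OF f])+)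
    fix G W
    assume "G \<in> hom SC Z W"
    then obtain D g where W: "ob_rep W D" and g: "\<Theta> \<rhd> [B] \<turnstile> g \<Colon> D" and G: "rep G B (inst g (Var 0)) D"
      using Z by (rule hom_rep_trg)
    note rules = G rules W
    note tys = g tys ob_wf[OF W]
    show "far (SM X) (cmp SC G F) = cmp SC (far (SM X) G) (far (SM X) F)"
      by (rule rep_eqI, (rule rules)+, simp add: single[OF f] single[OF g],
          rule ev_join, (rule tys | simp add: single[OF f] single[OF g])+)
  next
    fix Y Z assume "Y \<in> obj SC" "Z \<in> obj SC"
    then obtain A B where obs: "ob_rep Y A" "ob_rep Z B"
      by (auto simp: obj_iff)
    note rules = rep_rules obs
    note tys = ev_rules ty_intros obs[THEN ob_wf]
    show "str (SM X) Y Z \<in> hom SC (prd SC Y (fob (SM X) Z)) (fob (SM X) (prd SC Y Z))"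
      by (rule rep_hom rules)+
    show "cmp SC (str (SM X) Y Z) (prod_arr SC (ide SC Y) (unit (SM X) Z)) = unit (SM X) (prd SC Y Z)"
      \<comment> \<open>Evaluation ends at \<open>Ret X\<close> of the pair of both projections,
        while the other side is \<open>Ret X (Var 0)\<close>. Product eta is not an evaluation rule
        and is supplied for this last step.\<close>
      by (rule rep_eqI, (rule rules)+, simp,
          rule e_trans[OF _ e_ret[OF e_prod_eta]], (rule tys | simp)+)
    show "cmp SC (str (SM X) Y Z) (prod_arr SC (ide SC Y) (mult (SM X) Z))
        = cmp SC (mult (SM X) (prd SC Y Z)) (cmp SC (far (SM X) (str (SM X) Y Z)) (str (SM X) Y (fob (SM X) Z)))"
      by (rule rep_eqI, (rule rules)+, simp, rule ev_join, (rule tys | simp)+)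
    fix W assume "W \<in> obj SC"
    then obtain D where W: "ob_rep W D"
      by (auto simp: obj_iff)
    note rules = rules W
    note tys = tys W[THEN ob_wf]
    show "cmp SC (far (SM X) (assoc SC Y Z W)) (str (SM X) (prd SC Y Z) W)
        = cmp SC (str (SM X) Y (prd SC Z W)) (cmp SC (prod_arr SC (ide SC Y) (str (SM X) Z W)) (assoc SC Y Z (fob (SM X) W)))"
      by (rule rep_eqI, (rule rules)+, simp, rule ev_join, (rule tys | simp)+)
  next
    fix F G Y Y' Z Z' assume hom: "F \<in> hom SC Y Y'" "G \<in> hom SC Z Z'"
    from hom(1) obtain A A' f where f: "ob_rep Y A" "ob_rep Y' A'" "\<Theta> \<rhd> [A] \<turnstile> f \<Colon> A'"
      "rep F A (inst f (Var 0)) A'"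
      by (rule hom_reps)
    from hom(2) obtain B B' g where g: "ob_rep Z B" "ob_rep Z' B'" "\<Theta> \<rhd> [B] \<turnstile> g \<Colon> B'"
      "rep G B (inst g (Var 0)) B'"
      by (rule hom_reps)
    note rules = f(4) g(4) rep_rules f(1,2) g(1,2)
    note tys = f(3) g(3) ev_rules ty_intros f(1,2)[THEN ob_wf] g(1,2)[THEN ob_wf]
    show "cmp SC (far (SM X) (prod_arr SC F G)) (str (SM X) Y Z)
      = cmp SC (str (SM X) Y' Z') (prod_arr SC F (far (SM X) G))"
      apply (rule rep_eqI, (rule rules)+)
      apply (simp add: single[OF f(3)] single[OF g(3)])
      by (rule ev_join, (rule tys | simp add: single[OF f(3)] single[OF g(3)])+)
  qed
qed


section \<open>The syntactic central submonad\<close>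

lemma strong_monad_morphism_syn: "strong_monad_morphism SC (SM MS) (SM MT) (syn_iota \<Theta>)"
proof -
  interpret S: strong_monad SC "SM MS" by (rule strong_monad_syn)
  interpret T: strong_monad SC "SM MT" by (rule strong_monad_syn)
  show ?thesis
  proof
    fix Y assume "Y \<in> obj SC"
    then obtain A where Y: "ob_rep Y A"
      by (auto simp: obj_iff)
    note rules = rep_rules Y
    note tys = ev_rules ty_intros ob_wf[OF Y]
    show "syn_iota \<Theta> Y \<in> hom SC (fob (SM MS) Y) (fob (SM MT) Y)"
      by (rule rep_hom rules)+
    show "cmp SC (syn_iota \<Theta> Y) (unit (SM MS) Y) = unit (SM MT) Y"
      by (rule rep_eqI, (rule rules)+, simp, rule ev_join, (rule tys | simp)+)
    show "cmp SC (syn_iota \<Theta> Y) (mult (SM MS) Y)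
        = cmp SC (mult (SM MT) Y) (cmp SC (far (SM MT) (syn_iota \<Theta> Y)) (syn_iota \<Theta> (fob (SM MS) Y)))"
      by (rule rep_eqI, (rule rules)+, simp, rule ev_join, (rule tys | simp)+)
    fix Z assume "Z \<in> obj SC"
    then obtain B where Z: "ob_rep Z B"
      by (auto simp: obj_iff)
    note rules = rules Z
    note tys = tys ob_wf[OF Z]
    show "cmp SC (syn_iota \<Theta> (prd SC Y Z)) (str (SM MS) Y Z)
        = cmp SC (str (SM MT) Y Z) (prod_arr SC (ide SC Y) (syn_iota \<Theta> Z))"
      by (rule rep_eqI, (rule rules)+, simp, rule ev_join, (rule tys | simp)+)
  next
    fix F Y Z assume "F \<in> hom SC Y Z"
    then obtain A B f where Y: "ob_rep Y A" and Z: "ob_rep Z B"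
      and f: "\<Theta> \<rhd> [A] \<turnstile> f \<Colon> B" and F: "rep F A (inst f (Var 0)) B"
      by (rule hom_reps)
    note rules = F rep_rules Y Z
    note tys = f ev_rules ty_intros ob_wf[OF Y] ob_wf[OF Z]
    show "cmp SC (far (SM MT) F) (syn_iota \<Theta> Y) = cmp SC (syn_iota \<Theta> Z) (far (SM MS) F)"
      by (rule rep_eqI, (rule rules)+, simp add: single[OF f],
          rule ev_join, (rule tys | simp add: single[OF f])+)
  qed
qed

text \<open>Composing with \<open>syn_iota\<close> wraps a representative in \<open>Iota\<close>, so
  left cancellation is the injectivity rule for \<open>Iota\<close> over the source type.\<close>

lemma monic_syn_iota:
  assumes "X \<in> obj SC"
  shows "monic SC (syn_iota \<Theta> X)"
proof -
  obtain A where X: "ob_rep X A"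
    using assms by (auto simp: obj_iff)
  note iota = rep_iota[OF X]
  show ?thesis
    unfolding monic_def
  proof (intro conjI allI impI)
    show "syn_iota \<Theta> X \<in> arr SC"
      using iota by (auto simp: arr_iff)
  next
    fix Z F G
    assume hom: "F \<in> hom SC Z (src SC (syn_iota \<Theta> X))" "G \<in> hom SC Z (src SC (syn_iota \<Theta> X))"
      and eq: "cmp SC (syn_iota \<Theta> X) F = cmp SC (syn_iota \<Theta> X) G"
    from hom(1) ob_src[OF iota] obtain f B where Z: "ob_rep Z B"
      and F: "rep F B (inst f (Var 0)) (Mon MS A)"
      by (rule hom_rep_src)
    from hom(2) Z ob_src[OF iota] obtain g where G: "rep G B (inst g (Var 0)) (Mon MS A)"
      by (rule hom_rep)
    have "\<Theta> \<rhd> [B] \<turnstile> Iota (inst f (Var 0)) \<approx> Iota (inst g (Var 0)) \<Colon> Mon MT A"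
      using rep_eqD[of _ B "inst (Iota (Var 0)) (inst f (Var 0))"] rep_cmp[OF F iota] rep_cmp[OF G iota] eq
      by simp
    then have "\<Theta> \<rhd> [B] \<turnstile> inst f (Var 0) \<approx> inst g (Var 0) \<Colon> Mon MS A"
      by (rule e_iota_inj) (use F G in \<open>auto simp: rep_def\<close>)
    with F G show "F = G"
      by (rule rep_eqI)
  qed
qed

text \<open>Conjugating the strength by swaps evaluates to a single \<open>Do\<close> on the first
  component; this short form keeps the two sides of centrality close to the commutation
  axiom.\<close>

lemma rep_right_str:
  assumes "ob_rep Y A" "ob_rep Z B"
  shows "rep (right_str SC (SM X) Y Z) (Prod (Mon X A) B)
    (Do X (Pr1 (Var 0)) (Ret X (Pair (Var 0) (Pr2 (Var (Suc 0)))))) (Mon X (Prod A B))"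
proof -
  note tys = ev_rules ty_intros assms[THEN ob_wf]
  show ?thesis
    unfolding right_str_def
    by (rule rep_cong, (rule rep_rules assms)+, simp, rule ev_join, (rule tys | simp)+)
qed

lemma central_syn_iota:
  assumes "X \<in> obj SC"
  shows "central_cone SC (SM MT) X (fob (SM MS) X) (syn_iota \<Theta> X)"
proof -
  obtain A where X: "ob_rep X A"
    using assms by (auto simp: obj_iff)
  have "cmp SC (mult (SM MT) (prd SC X Y)) (cmp SC (far (SM MT) (right_str SC (SM MT) X Y))
          (cmp SC (str (SM MT) (fob (SM MT) X) Y) (prod_arr SC (syn_iota \<Theta> X) (ide SC (fob (SM MT) Y)))))
      = cmp SC (mult (SM MT) (prd SC X Y)) (cmp SC (far (SM MT) (str (SM MT) X Y))
          (cmp SC (right_str SC (SM MT) X (fob (SM MT) Y)) (prod_arr SC (syn_iota \<Theta> X) (ide SC (fob (SM MT) Y)))))"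
    (is "?L = ?R") if Y_obj: "Y \<in> obj SC" for Y
  proof -
    obtain B where Y: "ob_rep Y B"
      using Y_obj by (auto simp: obj_iff)
    note rules = rep_right_str rep_rules X Y
    note tys = ev_rules ty_intros ob_wf[OF X] ob_wf[OF Y]
    \<comment> \<open>The left composite binds the second component first, so under both binders
      index 0 is the first component and index 1 the second. The right composite binds in the other
      order, hence \<open>swap_vars ?P\<close>.\<close>
    let ?P = "Ret MT (Pair (Var 0) (Var (Suc 0)))"
    let ?\<Gamma> = "[Prod (Mon MS A) (Mon MT B)]"
    have "rep ?L (Prod (Mon MS A) (Mon MT B))
        (Do MT (Pr2 (Var 0)) (Do MT (Iota (Pr1 (Var (Suc 0)))) ?P)) (Mon MT (Prod A B))"
      by (rule rep_cong, (rule rules)+, simp, (rule tys | simp)+)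
    moreover have "rep ?R (Prod (Mon MS A) (Mon MT B))
        (Do MT (Iota (Pr1 (Var 0))) (Do MT (Pr2 (Var (Suc 0))) (swap_vars ?P))) (Mon MT (Prod A B))"
      by (rule rep_cong, (rule rules)+, simp add: swap_vars_def, (rule tys | simp add: swap_vars_def)+)
    \<comment> \<open>The axiom is used at \<open>swap_vars ?P\<close>; the exchange it performs
      undoes the one already there. It runs from the right composite to the left one, hence the
      \<open>e_sym\<close> below.\<close>
    moreover have "\<Theta> \<rhd> ?\<Gamma> \<turnstile> Do MT (Iota (Pr1 (Var 0))) (Do MT (lift (Pr2 (Var 0))) (swap_vars ?P))
        \<approx> Do MT (Pr2 (Var 0)) (Do MT (lift (Iota (Pr1 (Var 0)))) (swap_vars (swap_vars ?P))) \<Colon> Mon MT (Prod A B)"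
      by (rule e_central has_ty_swap tys)+
    ultimately show ?thesis
      using rep_eqI[OF _ _ e_sym] by (simp add: swap_vars_def)
  qed
  moreover have "syn_iota \<Theta> X \<in> hom SC (fob (SM MS) X) (fob (SM MT) X)"
    by (rule rep_hom rep_rules X)+
  ultimately show ?thesis
    by (simp add: central_cone_def)
qed

lemma csc_model_syn: "csc_model SC (SM MT) (SM MS) (syn_iota \<Theta>)"
proof -
  interpret strong_monad_morphism SC "SM MS" "SM MT" "syn_iota \<Theta>"
    by (rule strong_monad_morphism_syn)
  have "central_submonad SC (SM MS) (SM MT) (syn_iota \<Theta>)"
    by unfold_locales (rule monic_syn_iota, assumption, rule central_syn_iota, assumption)
  then show ?thesis
    unfolding csc_model_def using cartesian_closed_syn strong_monad_syn by blast
qed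

end


section \<open>The canonical interpretation\<close>

text \<open>Inverse to the projections that \<open>canon_tm\<close> substitutes for the variables.\<close>

primrec ctx_tuple :: "'g ctx \<Rightarrow> (nat \<Rightarrow> ('g, 'c) tm) \<Rightarrow> ('g, 'c) tm" where
  "ctx_tuple [] s = Star"
| "ctx_tuple (A # \<Gamma>) s = Pair (ctx_tuple \<Gamma> (\<lambda>n. s (Suc n))) (s 0)"

abbreviation ctx_pr :: "nat \<Rightarrow> ('g, 'c) tm" where
  "ctx_pr \<equiv> \<lambda>n. Pr2 ((Pr1 ^^ n) (Var 0))"

lemma inst_Pr1_funpow: "inst ((Pr1 ^^ n) M) P = (Pr1 ^^ n) (inst M P)"
  by (induction n) simp_all

lemma ren_Pr1_funpow: "ren ((Pr1 ^^ n) M) r = (Pr1 ^^ n) (ren M r)"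
  by (induction n) simp_all

context csc_theory
begin

section \<open>Interpretation over the packed context\<close>

abbreviation SO where "SO \<equiv> ctx_obj SC (ty_cls \<Theta>)"

lemma ob_cls: "wf_ty \<Theta> A \<Longrightarrow> ob_rep (ty_cls \<Theta> A) A"
  by (simp add: ob_rep_def)

lemma ob_ctx: "wf_ctx \<Theta> \<Gamma> \<Longrightarrow> ob_rep (SO \<Gamma>) (ctx_ty \<Gamma>)"
  by (induction \<Gamma>) (simp_all add: ob_one ob_prd ob_cls)

lemma rep_ctx_proj:
  "wf_ctx \<Theta> \<Gamma> \<Longrightarrow> n < length \<Gamma> \<Longrightarrow> rep (ctx_proj SC (ty_cls \<Theta>) \<Gamma> n) (ctx_ty \<Gamma>) (ctx_pr n) (\<Gamma> ! n)"
proof (induction \<Gamma> arbitrary: n)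
  case (Cons A \<Gamma>)
  then have obs: "ob_rep (SO \<Gamma>) (ctx_ty \<Gamma>)" "ob_rep (ty_cls \<Theta> A) A"
    using ob_ctx ob_cls by simp_all
  show ?case
  proof (cases n)
    case 0
    then show ?thesis
      using rep_proj2[OF obs] by simp
  next
    case (Suc m)
    then have "rep (ctx_proj SC (ty_cls \<Theta>) \<Gamma> m) (ctx_ty \<Gamma>) (ctx_pr m) (\<Gamma> ! m)"
      using Cons by simp
    \<comment> \<open>Composition places the additional \<open>Pr1\<close> innermost;
      \<open>funpow_swap1\<close> moves it to the front of the iterated projection.\<close>
    from rep_cmp[OF rep_proj1[OF obs] this] show ?thesis
      using Suc by (simp add: inst_Pr1_funpow funpow_swap1)
  qed
qed simp

lemma t_ctx_pr: "wf_ctx \<Theta> \<Gamma> \<Longrightarrow> n < length \<Gamma> \<Longrightarrow> \<Theta> \<rhd> [ctx_ty \<Gamma>] \<turnstile> ctx_pr n \<Colon> \<Gamma> ! n"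
  using rep_ctx_proj by (simp add: rep_def)

lemma ev_ctx_pr:
  assumes "\<Theta> \<rhd> \<Delta> \<turnstile> t \<approx> u \<Colon> ctx_ty \<Gamma>" "wf_ctx \<Theta> \<Gamma>" "n < length \<Gamma>"
  shows "\<Theta> \<rhd> \<Delta> \<turnstile> Pr2 ((Pr1 ^^ n) t) \<approx> Pr2 ((Pr1 ^^ n) u) \<Colon> \<Gamma> ! n"
  using ev_inst[OF t_ctx_pr[OF assms(2,3)] assms(1)] by (simp add: inst_Pr1_funpow)

lemma wf_ctx_ty: "wf_ctx \<Theta> \<Gamma> \<Longrightarrow> wf_ty \<Theta> (ctx_ty \<Gamma>)"
  by (rule ob_wf[OF ob_ctx])

lemma t_sub_ctx_pr: "\<Theta> \<rhd> \<Gamma> \<turnstile> M \<Colon> A \<Longrightarrow> \<Theta> \<rhd> [ctx_ty \<Gamma>] \<turnstile> sub M ctx_pr \<Colon> A"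
  by (frule has_ty_wf, erule has_ty_sub) (simp_all add: wf_ctx_ty t_ctx_pr)

lemma rep_canon: "\<Theta> \<rhd> \<Gamma> \<turnstile> M \<Colon> A \<Longrightarrow> rep (canon_tm \<Theta> \<Gamma> M A) (ctx_ty \<Gamma>) (sub M ctx_pr) A"
  by (simp add: rep_def canon_tm_def t_sub_ctx_pr)

text \<open>This is the binder case of the interpretation: packing the extended context and then
  splitting off its newest variable amounts to pushing the projections under the binder. The two
  terms differ by beta for pairs at every variable, so the agreement is provable, not
  syntactic.\<close>

lemma sub_ctx_pr_extend:
  assumes N: "\<Theta> \<rhd> A # \<Gamma> \<turnstile> N \<Colon> B"
  shows "\<Theta> \<rhd> [A, ctx_ty \<Gamma>] \<turnstile> inst (sub N ctx_pr) (Pair (Var (Suc 0)) (Var 0)) \<approx> sub N (up_sub ctx_pr) \<Colon> B"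
proof -
  let ?p = "Pair (Var (Suc 0)) (Var 0)"
  have wf: "wf_ty \<Theta> A" "wf_ctx \<Theta> \<Gamma>" "wf_ty \<Theta> (ctx_ty \<Gamma>)"
    using has_ty_wf[OF N] wf_ctx_ty by simp_all
  have "\<Theta> \<rhd> [A, ctx_ty \<Gamma>] \<turnstile> inst (ctx_pr n) ?p \<approx> up_sub ctx_pr n \<Colon> (A # \<Gamma>) ! n"
    if n: "n < length (A # \<Gamma>)" for n
  proof (cases n)
    case 0
    have "\<Theta> \<rhd> [A, ctx_ty \<Gamma>] \<turnstile> Pr2 ?p \<approx> Var 0 \<Colon> A"
      by (rule e_pr2_beta ty_intros wf)+
    with 0 show ?thesis
      by simp
  next
    case (Suc m)
    have "\<Theta> \<rhd> [A, ctx_ty \<Gamma>] \<turnstile> Pr1 ?p \<approx> Var (Suc 0) \<Colon> ctx_ty \<Gamma>"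
      by (rule e_pr1_beta ty_intros wf)+
    from ev_ctx_pr[OF this wf(2)] n Suc show ?thesis
      by (simp add: inst_Pr1_funpow ren_Pr1_funpow funpow_swap1)
  qed
  then have "\<Theta> \<rhd> [A, ctx_ty \<Gamma>] \<turnstile> sub N (\<lambda>n. inst (ctx_pr n) ?p) \<approx> sub N (up_sub ctx_pr) \<Colon> B"
    using wf by (intro sub_cong[OF N]) auto
  then show ?thesis
    unfolding inst_def sub_sub .
qed

text \<open>The strength pairs the ambient variable with the bound one, so the body, given over
  \<open>Prod D A\<close>, is evaluated at the pair of the two variables.\<close>

lemma rep_do:
  assumes M: "rep F D m (Mon X A)" and N: "rep G (Prod D A) n (Mon X B)"
    and obs: "ob_rep Z D" "ob_rep Y A" "ob_rep W B"
  shows "rep (cmp SC (mult (SM X) W) (cmp SC (far (SM X) G) (cmp SC (str (SM X) Z Y) (tuple SC (ide SC Z) F))))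
    D (Do X m (inst n (Pair (Var (Suc 0)) (Var 0)))) (Mon X B)"
proof -
  have m: "\<Theta> \<rhd> [D] \<turnstile> m \<Colon> Mon X A" and n: "\<Theta> \<rhd> [Prod D A] \<turnstile> n \<Colon> Mon X B"
    using M N by (auto simp: rep_def)
  have M': "rep F D (inst m (Var 0)) (Mon X A)" and N': "rep G (Prod D A) (inst n (Var 0)) (Mon X B)"
    using M N m n by (simp_all add: inst_self)
  note rules = M' N' rep_rules obs
  note tys = m n ev_rules ty_intros obs[THEN ob_wf]
  have "rep (cmp SC (mult (SM X) W) (cmp SC (far (SM X) G) (cmp SC (str (SM X) Z Y) (tuple SC (ide SC Z) F))))
    D (Do X (inst m (Var 0)) (inst n (Pair (Var (Suc 0)) (Var 0)))) (Mon X B)"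
    by (rule rep_cong, (rule rules)+, simp add: single[OF m] single[OF n],
        (rule tys | simp add: single[OF m] single[OF n])+)
  then show ?thesis
    using m by (simp add: inst_self)
qed

text \<open>\<open>canon_tm\<close> is one substitution and not a recursion on terms, so the
  standard clauses have to be proved. For most constructors the two representatives coincide
  syntactically; application needs beta for pairs, and the binders \<open>Lam\<close> and
  \<open>Do\<close> need \<open>sub_ctx_pr_extend\<close>.\<close>

lemma csc_interpretation_syn:
  "csc_interpretation \<Theta> SC (SM MT) (SM MS) (syn_iota \<Theta>) (ty_cls \<Theta>) (canon_tm \<Theta>)"
proof
  show "csc_model SC (SM MT) (SM MS) (syn_iota \<Theta>)"
    by (rule csc_model_syn)
  have case_SM: "(case X of MS \<Rightarrow> SM MS | MT \<Rightarrow> SM MT) = SM X" for X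
    by (cases X) simp_all
  show "ty_cls \<Theta> (Ground G) \<in> obj SC" if "G \<in> ground \<Theta>" for G
    using that by (intro obj_rep[OF ob_cls]) simp
  show "ty_cls \<Theta> Unit = one SC"
    using ob_one by (simp add: ob_rep_def)
  show "ty_cls \<Theta> (Mon X A) = fob (case X of MS \<Rightarrow> SM MS | MT \<Rightarrow> SM MT) (ty_cls \<Theta> A)"
    if "wf_ty \<Theta> A" for X A
    using ob_fob[OF ob_cls[OF that]] by (simp add: ob_rep_def case_SM)
  {
    fix A B assume "wf_ty \<Theta> A" "wf_ty \<Theta> B"
    note obs = this[THEN ob_cls]
    show "ty_cls \<Theta> (Fun A B) = expo SC (ty_cls \<Theta> A) (ty_cls \<Theta> B)"
      "ty_cls \<Theta> (Prod A B) = prd SC (ty_cls \<Theta> A) (ty_cls \<Theta> B)"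
      using ob_expo[OF obs] ob_prd[OF obs] by (simp_all add: ob_rep_def)
  }
  {
    fix \<Gamma> M A assume M: "\<Theta> \<rhd> \<Gamma> \<turnstile> M \<Colon> A"
    note r = rep_canon[OF M]
    have obs: "ob_rep (SO \<Gamma>) (ctx_ty \<Gamma>)" "ob_rep (ty_cls \<Theta> A) A"
      using has_ty_wf[OF M] by (simp_all add: ob_ctx ob_cls)
    show "canon_tm \<Theta> \<Gamma> M A \<in> hom SC (SO \<Gamma>) (ty_cls \<Theta> A)"
      using r obs by (rule rep_hom)
    show "canon_tm \<Theta> \<Gamma> M B = canon_tm \<Theta> \<Gamma> M A" if "\<Theta> \<rhd>\<^sub>t A \<approx> B" for B
      unfolding canon_tm_def
      using t_sub_ctx_pr[OF M] ty_refl[OF ob_wf[OF obs(1)]] that by (rule tm_cls_conv)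
    show "canon_tm \<Theta> \<Gamma> (Ret X M) (Mon X A)
        = cmp SC (unit (case X of MS \<Rightarrow> SM MS | MT \<Rightarrow> SM MT) (ty_cls \<Theta> A)) (canon_tm \<Theta> \<Gamma> M A)" for X
      using rep_unique[OF rep_canon[OF t_ret[OF M]]] rep_cmp[OF r rep_unit[OF obs(2)]]
      by (simp add: case_SM)
    show "canon_tm \<Theta> \<Gamma> (Pair M N) (Prod A B) = tuple SC (canon_tm \<Theta> \<Gamma> M A) (canon_tm \<Theta> \<Gamma> N B)"
      if "\<Theta> \<rhd> \<Gamma> \<turnstile> N \<Colon> B" for N B
      using rep_unique[OF rep_canon[OF t_pair[OF M that]]] rep_tuple[OF r rep_canon[OF that]] by simp
  }
  {
    fix \<Gamma> assume wf: "wf_ctx \<Theta> \<Gamma>"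
    show "canon_tm \<Theta> \<Gamma> (Var n) (\<Gamma> ! n) = ctx_proj SC (ty_cls \<Theta>) \<Gamma> n" if "n < length \<Gamma>" for n
      using rep_unique[OF rep_canon[OF t_var[OF wf that]]] rep_ctx_proj[OF wf that] by simp
    show "canon_tm \<Theta> \<Gamma> Star Unit = bang SC (SO \<Gamma>)"
      using rep_unique[OF rep_canon[OF t_star[OF wf]]] rep_bang[OF ob_ctx[OF wf]] by simp
    show "canon_tm \<Theta> \<Gamma> (Const c) A = cmp SC (canon_tm \<Theta> [] (Const c) A) (bang SC (SO \<Gamma>))"
      if c: "const_ty \<Theta> c = Some A" for c A
    proof -
      have "rep (canon_tm \<Theta> [] (Const c) A) Unit (Const c) A"
        using rep_canon[OF t_const[of _ "[]", OF _ c]] by simp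
      from rep_cmp[OF rep_bang[OF ob_ctx[OF wf]] this] show ?thesis
        using rep_unique[OF rep_canon[OF t_const[OF wf c]]] by simp
    qed
  }
  {
    fix \<Gamma> A M B assume M: "\<Theta> \<rhd> A # \<Gamma> \<turnstile> M \<Colon> B"
    then have obs: "ob_rep (SO \<Gamma>) (ctx_ty \<Gamma>)" "ob_rep (ty_cls \<Theta> A) A"
      using has_ty_wf[OF M] by (simp_all add: ob_ctx ob_cls)
    have "rep (canon_tm \<Theta> (A # \<Gamma>) M B) (Prod (ctx_ty \<Gamma>) A) (sub M ctx_pr) B"
      using rep_canon[OF M] by simp
    from rep_curry[OF this obs]
    show "canon_tm \<Theta> \<Gamma> (Lam A M) (Fun A B) = curry_arr SC (SO \<Gamma>) (ty_cls \<Theta> A) (canon_tm \<Theta> (A # \<Gamma>) M B)"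
      using e_lam[OF ty_refl[OF ob_wf[OF obs(2)]] sub_ctx_pr_extend[OF M], THEN e_sym]
      by (intro rep_eqI[OF rep_canon[OF t_lam[OF M]]]) simp_all
  }
  {
    fix \<Gamma> M N A B assume M: "\<Theta> \<rhd> \<Gamma> \<turnstile> M \<Colon> Fun A B" and N: "\<Theta> \<rhd> \<Gamma> \<turnstile> N \<Colon> A"
    have obs: "ob_rep (ty_cls \<Theta> A) A" "ob_rep (ty_cls \<Theta> B) B"
      using has_ty_wf[OF M] by (simp_all add: ob_cls)
    note m = t_sub_ctx_pr[OF M] and n = t_sub_ctx_pr[OF N]
    have "\<Theta> \<rhd> [ctx_ty \<Gamma>] \<turnstile> App (sub M ctx_pr) (sub N ctx_pr)
        \<approx> App (Pr1 (Pair (sub M ctx_pr) (sub N ctx_pr))) (Pr2 (Pair (sub M ctx_pr) (sub N ctx_pr))) \<Colon> B"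
      by (rule e_sym[OF e_app[OF e_pr1_beta[OF m n] e_pr2_beta[OF m n]]])
    then show "canon_tm \<Theta> \<Gamma> (App M N) B
        = cmp SC (ev SC (ty_cls \<Theta> A) (ty_cls \<Theta> B)) (tuple SC (canon_tm \<Theta> \<Gamma> M (Fun A B)) (canon_tm \<Theta> \<Gamma> N A))"
      by (intro rep_eqI[OF rep_canon[OF t_app[OF M N]]
            rep_cmp[OF rep_tuple[OF rep_canon[OF M] rep_canon[OF N]] rep_ev[OF obs]]]) simp
  }
  {
    fix \<Gamma> M A B assume M: "\<Theta> \<rhd> \<Gamma> \<turnstile> M \<Colon> Prod A B"
    have obs: "ob_rep (ty_cls \<Theta> A) A" "ob_rep (ty_cls \<Theta> B) B"
      using has_ty_wf[OF M] by (simp_all add: ob_cls)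
    show "canon_tm \<Theta> \<Gamma> (Pr1 M) A
      = cmp SC (proj1 SC (ty_cls \<Theta> A) (ty_cls \<Theta> B)) (canon_tm \<Theta> \<Gamma> M (Prod A B))"
      "canon_tm \<Theta> \<Gamma> (Pr2 M) B = cmp SC (proj2 SC (ty_cls \<Theta> A) (ty_cls \<Theta> B)) (canon_tm \<Theta> \<Gamma> M (Prod A B))"
      using rep_unique[OF rep_canon[OF t_pr1[OF M]]] rep_unique[OF rep_canon[OF t_pr2[OF M]]]
        rep_cmp[OF rep_canon[OF M] rep_proj1[OF obs]] rep_cmp[OF rep_canon[OF M] rep_proj2[OF obs]]
      by simp_all
  }
  {
    fix \<Gamma> M A assume M: "\<Theta> \<rhd> \<Gamma> \<turnstile> M \<Colon> Mon MS A"
    have obs: "ob_rep (ty_cls \<Theta> A) A"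
      using has_ty_wf[OF M] by (simp add: ob_cls)
    show "canon_tm \<Theta> \<Gamma> (Iota M) (Mon MT A)
      = cmp SC (syn_iota \<Theta> (ty_cls \<Theta> A)) (canon_tm \<Theta> \<Gamma> M (Mon MS A))"
      using rep_unique[OF rep_canon[OF t_iota[OF M]]] rep_cmp[OF rep_canon[OF M] rep_iota[OF obs]] by simp
  }
  {
    fix \<Gamma> M N X A B and R :: "('g cty, ('g, 'c) ctm) monad"
    assume M: "\<Theta> \<rhd> \<Gamma> \<turnstile> M \<Colon> Mon X A" and N: "\<Theta> \<rhd> A # \<Gamma> \<turnstile> N \<Colon> Mon X B"
      and R: "R = (case X of MS \<Rightarrow> SM MS | MT \<Rightarrow> SM MT)"
    have obs: "ob_rep (SO \<Gamma>) (ctx_ty \<Gamma>)" "ob_rep (ty_cls \<Theta> A) A" "ob_rep (ty_cls \<Theta> B) B"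
      using has_ty_wf[OF M] has_ty_wf[OF N] by (simp_all add: ob_ctx ob_cls)
    have "rep (canon_tm \<Theta> (A # \<Gamma>) N (Mon X B)) (Prod (ctx_ty \<Gamma>) A) (sub N ctx_pr) (Mon X B)"
      using rep_canon[OF N] by simp
    from rep_do[OF rep_canon[OF M] this obs]
    show "canon_tm \<Theta> \<Gamma> (Do X M N) (Mon X B)
        = cmp SC (mult R (ty_cls \<Theta> B)) (cmp SC (far R (canon_tm \<Theta> (A # \<Gamma>) N (Mon X B)))
            (cmp SC (str R (SO \<Gamma>) (ty_cls \<Theta> A)) (tuple SC (ide SC (SO \<Gamma>)) (canon_tm \<Theta> \<Gamma> M (Mon X A)))))"
      using e_do[OF e_refl[OF t_sub_ctx_pr[OF M]] sub_ctx_pr_extend[OF N], THEN e_sym]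
      unfolding R case_SM by (intro rep_eqI[OF rep_canon[OF t_do[OF M N]]]) simp_all
  }
qed

section \<open>Unpacking the context, soundness and completeness\<close>

lemma t_ctx_tuple:
  assumes "wf_ctx \<Theta> \<Delta>" "\<And>n. n < length \<Gamma> \<Longrightarrow> \<Theta> \<rhd> \<Delta> \<turnstile> s n \<Colon> \<Gamma> ! n"
  shows "\<Theta> \<rhd> \<Delta> \<turnstile> ctx_tuple \<Gamma> s \<Colon> ctx_ty \<Gamma>"
  using assms(2)
proof (induction \<Gamma> arbitrary: s)
  case Nil
  then show ?case
    using assms(1) by (simp add: t_star)
next
  case (Cons A \<Gamma>)
  have "\<Theta> \<rhd> \<Delta> \<turnstile> s 0 \<Colon> A" "\<Theta> \<rhd> \<Delta> \<turnstile> s (Suc n) \<Colon> \<Gamma> ! n" if "n < length \<Gamma>" for n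
    using Cons.prems[of 0] Cons.prems[of "Suc n"] that by simp_all
  then show ?case
    using Cons.IH[of "\<lambda>n. s (Suc n)"] Cons.prems[of 0] by (auto intro: t_pair)
qed

text \<open>The application is to \<open>Var\<close>, but the induction needs arbitrary
  \<open>s\<close>: removing the newest variable shifts the family to
  \<open>\<lambda>n. s (Suc n)\<close>.\<close>

lemma ctx_pr_tuple:
  assumes "wf_ctx \<Theta> \<Delta>" "wf_ctx \<Theta> \<Gamma>" "\<And>n. n < length \<Gamma> \<Longrightarrow> \<Theta> \<rhd> \<Delta> \<turnstile> s n \<Colon> \<Gamma> ! n" "n < length \<Gamma>"
  shows "\<Theta> \<rhd> \<Delta> \<turnstile> inst (ctx_pr n) (ctx_tuple \<Gamma> s) \<approx> s n \<Colon> \<Gamma> ! n"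
  using assms(2-)
proof (induction \<Gamma> arbitrary: s n)
  case (Cons A \<Gamma>)
  have s: "\<Theta> \<rhd> \<Delta> \<turnstile> s (Suc n) \<Colon> \<Gamma> ! n" if "n < length \<Gamma>" for n
    using Cons.prems(2)[of "Suc n"] that by simp
  have t: "\<Theta> \<rhd> \<Delta> \<turnstile> ctx_tuple \<Gamma> (\<lambda>n. s (Suc n)) \<Colon> ctx_ty \<Gamma>" and s0: "\<Theta> \<rhd> \<Delta> \<turnstile> s 0 \<Colon> A"
    using t_ctx_tuple[OF assms(1) s] Cons.prems(2)[of 0] by simp_all
  show ?case
  proof (cases n)
    case 0
    then show ?thesis
      using e_pr2_beta[OF t s0] by simp
  next
    case (Suc m)
    then have m: "m < length \<Gamma>" and wf: "wf_ctx \<Theta> \<Gamma>"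
      using Cons.prems by simp_all
    have "\<Theta> \<rhd> \<Delta> \<turnstile> inst (ctx_pr m) (ctx_tuple \<Gamma> (\<lambda>n. s (Suc n))) \<approx> s (Suc m) \<Colon> \<Gamma> ! m"
      using Cons.IH[OF wf, of "\<lambda>n. s (Suc n)"] s m by simp
    with ev_ctx_pr[OF e_pr1_beta[OF t s0] wf m] show ?thesis
      using Suc by (auto simp: inst_Pr1_funpow funpow_swap1 intro: e_trans)
  qed
qed simp

text \<open>Soundness takes no new induction over derivations: both interpretations arise by the
  same substitution, under which provable equality is already closed.\<close>

lemma canon_tm_eq_iff:
  assumes M: "\<Theta> \<rhd> \<Gamma> \<turnstile> M \<Colon> A" and N: "\<Theta> \<rhd> \<Gamma> \<turnstile> N \<Colon> A"
  shows "\<Theta> \<rhd> \<Gamma> \<turnstile> M \<approx> N \<Colon> A \<longleftrightarrow> canon_tm \<Theta> \<Gamma> M A = canon_tm \<Theta> \<Gamma> N A"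
proof
  have wf: "wf_ctx \<Theta> \<Gamma>"
    using has_ty_wf[OF M] by blast
  {
    assume "\<Theta> \<rhd> \<Gamma> \<turnstile> M \<approx> N \<Colon> A"
    then have "\<Theta> \<rhd> [ctx_ty \<Gamma>] \<turnstile> sub M ctx_pr \<approx> sub N ctx_pr \<Colon> A"
      by (rule tm_eq_sub) (auto simp: wf_ctx_ty wf t_ctx_pr)
    then show "canon_tm \<Theta> \<Gamma> M A = canon_tm \<Theta> \<Gamma> N A"
      by (rule rep_eqI[OF rep_canon[OF M] rep_canon[OF N]])
  next
    assume "canon_tm \<Theta> \<Gamma> M A = canon_tm \<Theta> \<Gamma> N A"
    then have eq: "\<Theta> \<rhd> [ctx_ty \<Gamma>] \<turnstile> sub M ctx_pr \<approx> sub N ctx_pr \<Colon> A"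
      using rep_eqD rep_canon[OF M] rep_canon[OF N] by metis
    let ?t = "ctx_tuple \<Gamma> Var"
    have t: "\<Theta> \<rhd> \<Gamma> \<turnstile> ?t \<Colon> ctx_ty \<Gamma>"
      using wf t_var[OF wf] by (rule t_ctx_tuple)
    \<comment> \<open>Packing followed by unpacking composes to one substitution whose value at each
      variable is provably that variable; \<open>sub_cong\<close> lifts this to
      \<open>P\<close>.\<close>
    have recover: "\<Theta> \<rhd> \<Gamma> \<turnstile> inst (sub P ctx_pr) ?t \<approx> P \<Colon> A" if "\<Theta> \<rhd> \<Gamma> \<turnstile> P \<Colon> A" for P
    proof -
      have "\<Theta> \<rhd> \<Gamma> \<turnstile> sub P (\<lambda>n. inst (ctx_pr n) ?t) \<approx> sub P Var \<Colon> A"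
        using that wf ctx_pr_tuple[OF wf wf t_var[OF wf]] by (rule sub_cong)
      then show ?thesis
        unfolding inst_def sub_sub sub_Var .
    qed
    from inst_single_cong[OF eq e_refl[OF t]] show "\<Theta> \<rhd> \<Gamma> \<turnstile> M \<approx> N \<Colon> A"
      using recover[OF M] recover[OF N] by (blast intro: e_sym e_trans)
  }
qed

end

theorem mainTheorem13:
  fixes \<Theta> :: "('g, 'c) csc_presentation"
  assumes "csc_theory \<Theta>"
  shows "csc_model (syn_cat \<Theta>) (syn_monad \<Theta> MT) (syn_monad \<Theta> MS) (syn_iota \<Theta>)
    \<and> csc_interpretation \<Theta> (syn_cat \<Theta>) (syn_monad \<Theta> MT) (syn_monad \<Theta> MS) (syn_iota \<Theta>)
        (ty_cls \<Theta>) (canon_tm \<Theta>)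
    \<and> (\<forall>A B. wf_ty \<Theta> A \<longrightarrow> wf_ty \<Theta> B \<longrightarrow>
        (\<Theta> \<rhd>\<^sub>t A \<approx> B \<longleftrightarrow> ty_cls \<Theta> A = ty_cls \<Theta> B))
    \<and> (\<forall>\<Gamma> M N A. \<Theta> \<rhd> \<Gamma> \<turnstile> M \<Colon> A \<longrightarrow> \<Theta> \<rhd> \<Gamma> \<turnstile> N \<Colon> A \<longrightarrow>
        (\<Theta> \<rhd> \<Gamma> \<turnstile> M \<approx> N \<Colon> A \<longleftrightarrow> canon_tm \<Theta> \<Gamma> M A = canon_tm \<Theta> \<Gamma> N A))"
proof -
  interpret csc_theory \<Theta> by fact
  show ?thesis
    using csc_model_syn csc_interpretation_syn canon_tm_eq_iff by (simp add: ty_cls_eq_iff)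
qed

end
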